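(* Let $\gamma:[0,1]\to\mathbb{R}^d$ be a non-degenerate piecewise linear path with derivative $f$ such that $\lVert f(t)\rVert_2=1$ for all $t\in(0,1)$ at which it is defined. Assume $\gamma$ is differentiable at $\theta\in(0,1)$. For $n\ge1$ put $p=p(n)=\lfloor\theta(n+2)\rfloor$ (which lies in $\{1,\dots,n+1\}$ for all large $n$; only such $n$ are considered), and let $$x^*_{\theta,n}\in\operatorname*{argmin}_{x\in\mathbb{R}^d,\ \lVert x\rVert_2=1}\ \left\lVert I_{p,n}(x)-\bar S_{n+1}\right\rVert_\pi .$$ Then there exists a strictly increasing sequence $(n_k)_{k\ge1}$ of natural numbers such that $x^*_{\theta,n_k}\to f(\theta)$ as $k\to\infty$.
   Context: Normalised signature: $\bar S_n:=n!\int_{0<u_1<\cdots<u_n<1}f(u_1)\otimes\cdots\otimes f(u_n)\,du_1\cdots du_n\in(\mathbb{R}^d)^{\otimes n}$. Insertion map: for $p\in\{1,\dots,n+1\}$, $I_{p,n}:\mathbb{R}^d\to(\mathbb{R}^d)^{\otimes(n+1)}$ is $$I_{p,n}(x):=n!\int_{0<u_1<\cdots<u_n<1}f(u_1)\otimes\cdots\otimes f(u_{p-1})\otimes x\otimes f(u_p)\otimes\cdots\otimes f(u_n)\,du_1\cdots du_n .$$ $\lVert\cdot\rVert_2$ is the Euclidean norm, and $\lVert\cdot\rVert_\pi$ is the projective tensor norm on $(\mathbb{R}^d)^{\otimes k}$ induced by it: $\lVert x\rVert_\pi=\inf\sum_i\lVert v_{i,1}\rVert_2\cdots\lVert v_{i,k}\rVert_2$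 over finite representations $x=\sum_i v_{i,1}\otimes\cdots\otimes v_{i,k}$. Non-degenerate piecewise linear path: a (continuous) concatenation of finitely many line segments of positive length with successive vertices $x_0,\dots,x_M$ such that for each $0<i<M$ the angle in $[0,\pi]$ between $x_{i-1}-x_i$ and $x_{i+1}-x_i$ lies in $(0,\pi)$. The argmin is nonempty; $x^*_{\theta,n}$ denotes any chosen minimiser. *)

theory Defs
  imports "HOL-Analysis.Analysis"
begin

section \<open>Tensors\<close>

text \<open>
  A tensor of order \<open>k\<close> over \<open>real^'d\<close> is given by its coordinates in the standard basis: a
  function on lists of indices that vanishes on all lists whose length is not \<open>k\<close>. The order is
  thus an ordinary natural number, and vector space operations and integrals are coordinatewise.
\<close>

type_synonym 'd tensor = "'d list \<Rightarrow> real"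

definition pure_tensor :: "(real^'d) list \<Rightarrow> 'd tensor" where
  "pure_tensor vs = (\<lambda>is. if length is = length vs
     then \<Prod>j<length vs. (vs ! j) $ (is ! j) else 0)"

text \<open>
  On tensors of order \<open>k\<close> the set below is nonempty and bounded below by \<open>0\<close>, so that the
  infimum is the usual one. Representations are finite lists of lists of \<open>k\<close> factors.
\<close>

definition proj_norm :: "nat \<Rightarrow> 'd::finite tensor \<Rightarrow> real" where
  "proj_norm k T = Inf {\<Sum>vs\<leftarrow>reps. \<Prod>v\<leftarrow>vs. norm v | reps :: (real^'d) list list.
     (\<forall>vs\<in>set reps. length vs = k) \<and> T = (\<lambda>is. \<Sum>vs\<leftarrow>reps. pure_tensor vs is)}"

section \<open>Signature and insertion map\<close>

definition open_simplex :: "nat \<Rightarrow> (nat \<Rightarrow> real) set" where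
  "open_simplex n = {u \<in> {1..n} \<rightarrow>\<^sub>E UNIV.
     (\<forall>i\<in>{1..n}. 0 < u i \<and> u i < 1) \<and> (\<forall>i\<in>{1..n}. \<forall>j\<in>{1..n}. i < j \<longrightarrow> u i < u j)}"

definition simplex_integral :: "nat \<Rightarrow> ((nat \<Rightarrow> real) \<Rightarrow> 'd tensor) \<Rightarrow> 'd tensor" where
  "simplex_integral n F =
     (\<lambda>is. LINT u:open_simplex n|(Pi\<^sub>M {1..n} (\<lambda>_. lborel)). F u is)"

definition norm_signature :: "(real \<Rightarrow> real^'d) \<Rightarrow> nat \<Rightarrow> 'd tensor" where
  "norm_signature f n = (\<lambda>is. fact n *
     simplex_integral n (\<lambda>u. pure_tensor (map (\<lambda>j. f (u j)) [1..<n+1])) is)"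

definition insertion :: "(real \<Rightarrow> real^'d) \<Rightarrow> nat \<Rightarrow> nat \<Rightarrow> real^'d \<Rightarrow> 'd tensor" where
  "insertion f p n x = (\<lambda>is. fact n *
     simplex_integral n (\<lambda>u. pure_tensor
       (map (\<lambda>j. f (u j)) [1..<p] @ [x] @ map (\<lambda>j. f (u j)) [p..<n+1])) is)"

section \<open>Non-degenerate piecewise linear paths\<close>

definition vec_angle :: "'a::real_inner \<Rightarrow> 'a \<Rightarrow> real" where
  "vec_angle v w = arccos (inner v w / (norm v * norm w))"

text \<open>
  The path runs affinely through the vertices \<open>x 0, \<dots>, x M\<close>, reaching \<open>x i\<close> at time \<open>\<tau> i\<close>.
  The segments may be traversed at different speeds.
\<close>

definition nondegenerate_pl_path :: "(real \<Rightarrow> 'a::real_inner) \<Rightarrow> bool" where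
  "nondegenerate_pl_path \<gamma> \<longleftrightarrow> (\<exists>(M::nat) (\<tau> :: nat \<Rightarrow> real) (x :: nat \<Rightarrow> 'a).
     \<tau> 0 = 0 \<and> \<tau> M = 1 \<and> (\<forall>i<M. \<tau> i < \<tau> (i+1)) \<and>
     (\<forall>i<M. x i \<noteq> x (i+1)) \<and>
     (\<forall>i<M. \<forall>t\<in>{\<tau> i..\<tau> (i+1)}.
        \<gamma> t = linepath (x i) (x (i+1)) ((t - \<tau> i) / (\<tau> (i+1) - \<tau> i))) \<and>
     (\<forall>i. 0 < i \<and> i < M \<longrightarrow> vec_angle (x (i-1) - x i) (x (i+1) - x i) \<in> {0<..<pi}))"

section \<open>Insertion position\<close>

definition ins_pos :: "real \<Rightarrow> nat \<Rightarrow> nat" where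
  "ins_pos \<theta> n = nat \<lfloor>\<theta> * (real n + 2)\<rfloor>"

definition admissible :: "real \<Rightarrow> nat \<Rightarrow> bool" where
  "admissible \<theta> n \<longleftrightarrow> n \<ge> 1 \<and> ins_pos \<theta> n \<in> {1..n+1}"

end

theory Submission
  imports Defs "HOL-Library.Multiset"
begin

text \<open>
  Write \<open>e = f \<theta>\<close>, let \<open>\<tau> 0 < \<dots> < \<tau> M\<close> be the vertex times of the path, \<open>v i\<close> the direction of segment
  \<open>i\<close>, and \<open>gap i = \<tau> (i+1) - \<tau> i\<close>. The directions are unit vectors, and the angle condition says that
  consecutive ones are neither equal nor opposite. In particular the path is differentiable at no
  vertex, so \<open>\<theta>\<close> lies strictly inside a segment \<open>i\<close> and \<open>e = v i\<close>.

  Since \<open>f\<close> is almost everywhere one of the \<open>v i\<close>, both tensors are finite sums of pure tensors. If \<open>n\<close>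
  independent uniform points of \<open>[0,1]\<close> are sorted, the segments that contain them form a
  nondecreasing word in the letters \<open>0, \<dots>, M-1\<close>, that is, a multiset, and its letter counts are
  multinomial with parameters \<open>gap\<close>. The normalised signature is the expectation of
  \<open>v w\<^sub>1 \<otimes> \<dots> \<otimes> v w\<^sub>n\<close> over such words \<open>w\<close>, and the insertion map is the same expectation with an
  extra factor (\<open>simplex_integral_words\<close>).

  Upper bound: inserting \<open>e\<close> nearly reproduces the signature. Adding a letter \<open>i\<close> to a random word of
  length \<open>n\<close> gives a word of length \<open>n+1\<close> whose law has density \<open>K / ((n+1) gap i)\<close> with respect to the
  multinomial law, \<open>K\<close> being the number of letters \<open>i\<close> (\<open>size_bias\<close>). This density tends to \<open>1\<close> in mean.
  Inserting at position \<open>p\<close> agrees with inserting in order when the \<open>p\<close>-th letter of the longer word is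
  \<open>i\<close>, and since \<open>p / n\<close> tends to \<open>\<theta>\<close>, the \<open>p\<close>-th letter differs from \<open>i\<close> with probability tending to
  \<open>0\<close>. Both facts follow from the variance of multinomial counts. Hence the projective norm at \<open>x = e\<close>
  tends to \<open>0\<close> (\<open>proj_norm_insertion_tangent_le\<close>), and a fortiori so does its value at the minimiser.

  Lower bound: for large \<open>n\<close> the insertion map shrinks vectors at most by a constant factor, and this
  factor does not depend on \<open>n\<close>. The projective norm dominates every
  contraction of the tensor by bilinear operators of norm at most \<open>1\<close>
  (\<open>norm_contract_le_proj_norm\<close>). At position \<open>p\<close> the operator is multiplication by the inner product
  with the direction of \<open>x - e\<close>; at the other positions it is \<open>boost v (y, s) = (s v, \<langle>v, y\<rangle>)\<close>, the
  infinitesimal Lorentz boost that also underlies the hyperbolic development of a path. For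
  unit \<open>v\<close> it is symmetric with eigenvalues \<open>1\<close>, \<open>0\<close> and \<open>-1\<close>, and \<open>1\<close> is simple with eigenvector \<open>(v, 1)\<close>.
  Averaged over words, the eigenvalues other than \<open>1\<close> contribute exponentially small terms, and what
  survives is a product of projections onto the lines through \<open>(v i, 1)\<close>; it is nonzero because
  \<open>\<langle>v i, v (i+1)\<rangle> > -1\<close>. So the contraction of the signature is bounded away from \<open>0\<close>
  (\<open>boost_word_sum_bounded_below\<close>).

  By \<open>dist_le_proj_norm_insertion\<close> the two bounds combine: \<open>x*\<close> tends to \<open>e\<close> along all large \<open>n\<close>.
\<close>

section \<open>Bounds for the projective norm\<close>

lemma pure_tensor_Nil: "pure_tensor [] is = (if is = [] then 1 else 0)"
  by (simp add: pure_tensor_def)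

lemma pure_tensor_Cons:
  "pure_tensor (v # vs) (i # is) = v $ i * pure_tensor vs is"
  by (simp add: pure_tensor_def prod.lessThan_Suc_shift del: prod.lessThan_Suc)

text \<open>
  A representation in the definition of \<^const>\<open>proj_norm\<close> carries no coefficients; here each one is
  moved into the first factor, which exists because \<open>k \<ge> 1\<close>.
\<close>
lemma finite_sum_representation:
  fixes vs :: "'a \<Rightarrow> (real^'d::finite) list"
  assumes "finite S" "k \<ge> 1" "\<And>a. a \<in> S \<Longrightarrow> length (vs a) = k"
    and T: "\<And>is. T is = (\<Sum>a\<in>S. c a * pure_tensor (vs a) is)"
  obtains reps where "\<forall>us\<in>set reps. length us = k"
    "T = (\<lambda>is. \<Sum>us\<leftarrow>reps. pure_tensor us is)"
    "(\<Sum>us\<leftarrow>reps. \<Prod>u\<leftarrow>us. norm u) = (\<Sum>a\<in>S. \<bar>c a\<bar> * (\<Prod>u\<leftarrow>vs a. norm u))"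
proof -
  obtain as where as: "set as = S" "distinct as"
    using finite_distinct_list[OF \<open>finite S\<close>] by blast
  define g where "g a = (c a *\<^sub>R hd (vs a)) # tl (vs a)" for a
  have ne: "\<exists>u us. vs a = u # us" if "a \<in> S" for a
    using assms(2) assms(3)[OF that] by (cases "vs a") auto
  have len: "length (g a) = k" if "a \<in> S" for a
    using ne[OF that] assms(3)[OF that] by (force simp: g_def)
  have pure: "pure_tensor (g a) is = c a * pure_tensor (vs a) is" if a: "a \<in> S" for a "is"
  proof -
    obtain u us where "vs a = u # us" using ne[OF a] by blast
    then show ?thesis
      by (cases "is") (simp_all add: g_def pure_tensor_Cons, simp add: pure_tensor_def)
  qed
  have nrm: "(\<Prod>u\<leftarrow>g a. norm u) = \<bar>c a\<bar> * (\<Prod>u\<leftarrow>vs a. norm u)" if "a \<in> S" for a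
    using ne[OF that] by (auto simp: g_def)
  have sums: "(\<Sum>us\<leftarrow>map g as. h us) = (\<Sum>a\<in>S. h (g a))" for h :: "_ \<Rightarrow> real"
    using as by (simp add: sum_list_distinct_conv_sum_set o_def)
  show ?thesis
  proof
    show "\<forall>us\<in>set (map g as). length us = k" using len as by auto
    show "T = (\<lambda>is. \<Sum>us\<leftarrow>map g as. pure_tensor us is)"
      unfolding sums using pure T by (auto intro!: ext sum.cong)
    show "(\<Sum>us\<leftarrow>map g as. \<Prod>u\<leftarrow>us. norm u) = (\<Sum>a\<in>S. \<bar>c a\<bar> * (\<Prod>u\<leftarrow>vs a. norm u))"
      unfolding sums using nrm by (auto intro!: sum.cong)
  qed
qed

lemma proj_norm_le_sum:
  fixes vs :: "'a \<Rightarrow> (real^'d::finite) list"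
  assumes "finite S" "k \<ge> 1" "\<And>a. a \<in> S \<Longrightarrow> length (vs a) = k"
    and "\<And>is. T is = (\<Sum>a\<in>S. c a * pure_tensor (vs a) is)"
  shows "proj_norm k T \<le> (\<Sum>a\<in>S. \<bar>c a\<bar> * (\<Prod>u\<leftarrow>vs a. norm u))"
proof -
  obtain reps where r: "\<forall>us\<in>set reps. length us = k"
    "T = (\<lambda>is. \<Sum>us\<leftarrow>reps. pure_tensor us is)"
    "(\<Sum>us\<leftarrow>reps. \<Prod>u\<leftarrow>us. norm u) = (\<Sum>a\<in>S. \<bar>c a\<bar> * (\<Prod>u\<leftarrow>vs a. norm u))"
    using finite_sum_representation[of S k vs T c] assms by blast
  show ?thesis
    unfolding proj_norm_def r(3)[symmetric]
    by (rule cInf_lower)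
      (use r(1,2) in \<open>auto intro!: bdd_belowI[where m=0] sum_list_nonneg prod_list_nonneg\<close>)
qed

text \<open>
  A list \<open>Bs\<close> of bilinear maps and a start vector \<open>z\<close> turn a list of vectors into
  \<open>B\<^sub>1 v\<^sub>1 (B\<^sub>2 v\<^sub>2 (\<dots> z))\<close>. This is multilinear in the vectors, so it has an extension to all
  tensors, which \<open>contract\<close> below computes from the coordinates.
\<close>
primrec apply_ops ::
  "('v \<Rightarrow> 'z \<Rightarrow> 'z) list \<Rightarrow> 'z \<Rightarrow> 'v list \<Rightarrow> 'z" where
  "apply_ops [] z vs = z"
| "apply_ops (B # Bs) z vs = B (hd vs) (apply_ops Bs z (tl vs))"

primrec contract ::
  "(real^'d::finite \<Rightarrow> 'z \<Rightarrow> 'z) list \<Rightarrow> 'z::real_normed_vector \<Rightarrow> 'd tensor \<Rightarrow> 'z" where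
  "contract [] z T = T [] *\<^sub>R z"
| "contract (B # Bs) z T = (\<Sum>i\<in>UNIV. B (axis i 1) (contract Bs z (\<lambda>is. T (i # is))))"

lemma contract_scale:
  assumes "\<And>B. B \<in> set Bs \<Longrightarrow> bounded_bilinear B"
  shows "contract Bs z (\<lambda>is. c * T is) = c *\<^sub>R contract Bs z T"
  using assms
proof (induction Bs arbitrary: T)
  case (Cons B Bs)
  then have "bounded_bilinear B" by simp
  then show ?case
    using Cons by (simp add: bounded_bilinear.scaleR_right scaleR_sum_right)
qed simp

lemma contract_diff:
  assumes "\<And>B. B \<in> set Bs \<Longrightarrow> bounded_bilinear B"
  shows "contract Bs z (\<lambda>is. T is - U is) = contract Bs z T - contract Bs z U"
  using assms
proof (induction Bs arbitrary: T U)
  case (Cons B Bs)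
  then have "bounded_bilinear B" by simp
  then show ?case
    using Cons by (simp add: bounded_bilinear.diff_right sum_subtractf)
qed (simp add: scaleR_left_diff_distrib)

lemma contract_add:
  assumes "\<And>B. B \<in> set Bs \<Longrightarrow> bounded_bilinear B"
  shows "contract Bs z (\<lambda>is. T is + U is) = contract Bs z T + contract Bs z U"
  using contract_diff[OF assms, of Bs z T "\<lambda>is. -1 * U is"] contract_scale[OF assms, of Bs z "-1" U]
  by simp

lemma contract_zero:
  assumes "\<And>B. B \<in> set Bs \<Longrightarrow> bounded_bilinear B"
  shows "contract Bs z (\<lambda>is. 0) = 0"
  using contract_scale[OF assms, of Bs z 0 "\<lambda>_. 0"] by simp

lemma contract_sum:
  assumes "\<And>B. B \<in> set Bs \<Longrightarrow> bounded_bilinear B"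
  shows "contract Bs z (\<lambda>is. \<Sum>a\<in>S. T a is) = (\<Sum>a\<in>S. contract Bs z (T a))"
  by (induction S rule: infinite_finite_induct)
    (simp_all add: contract_zero[OF assms] contract_add[OF assms])

lemma contract_sum_list:
  assumes "\<And>B. B \<in> set Bs \<Longrightarrow> bounded_bilinear B"
  shows "contract Bs z (\<lambda>is. \<Sum>a\<leftarrow>as. T a is) = (\<Sum>a\<leftarrow>as. contract Bs z (T a))"
  by (induction as) (simp_all add: contract_zero[OF assms] contract_add[OF assms])

lemma contract_pure_tensor:
  assumes "\<And>B. B \<in> set Bs \<Longrightarrow> bounded_bilinear B" "length vs = length Bs"
  shows "contract Bs z (pure_tensor vs) = apply_ops Bs z vs"
  using assms
proof (induction Bs arbitrary: vs)
  case Nil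
  then show ?case by (simp add: pure_tensor_Nil)
next
  case (Cons B Bs)
  interpret B: bounded_bilinear B using Cons.prems by simp
  obtain v us where vs: "vs = v # us" using Cons.prems by (cases vs) auto
  have "contract (B # Bs) z (pure_tensor vs)
      = (\<Sum>i\<in>UNIV. B (v $ i *\<^sub>R axis i 1) (apply_ops Bs z us))"
    using Cons by (simp add: vs pure_tensor_Cons contract_scale B.scaleR_left B.scaleR_right)
  also have "\<dots> = B (\<Sum>i\<in>UNIV. v $ i *\<^sub>R axis i 1) (apply_ops Bs z us)"
    by (simp add: B.sum_left)
  also have "(\<Sum>i\<in>UNIV. v $ i *\<^sub>R axis i 1) = v"
    using basis_expansion[of v] by (simp add: scalar_mult_eq_scaleR)
  finally show ?case by (simp add: vs)
qed

lemma norm_apply_ops_le: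
  assumes "\<And>B v x. B \<in> set Bs \<Longrightarrow> norm (B v x) \<le> norm v * norm x" "length vs = length Bs"
  shows "norm (apply_ops Bs z vs) \<le> (\<Prod>v\<leftarrow>vs. norm v) * norm z"
  using assms
proof (induction Bs arbitrary: vs)
  case (Cons B Bs)
  obtain v us where vs: "vs = v # us" using Cons.prems by (cases vs) auto
  have "norm (apply_ops (B # Bs) z vs) \<le> norm v * norm (apply_ops Bs z us)"
    using Cons.prems by (simp add: vs)
  also have "\<dots> \<le> norm v * ((\<Prod>v\<leftarrow>us. norm v) * norm z)"
    using Cons vs by (intro mult_left_mono) auto
  finally show ?case by (simp add: vs mult.assoc)
qed simp

text \<open>
  Every representation of \<open>T\<close> bounds the contraction by the triangle inequality. That \<open>T\<close> is a finite
  combination of pure tensors is assumed so that the infimum is taken over a nonempty set.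
\<close>
lemma norm_contract_le_proj_norm:
  fixes vs :: "'a \<Rightarrow> (real^'d::finite) list"
  assumes bil: "\<And>B. B \<in> set Bs \<Longrightarrow> bounded_bilinear B"
    and bnd: "\<And>B v x. B \<in> set Bs \<Longrightarrow> norm (B v x) \<le> norm v * norm x"
    and "finite S" "length Bs = k" "k \<ge> 1" "\<And>a. a \<in> S \<Longrightarrow> length (vs a) = k"
    and "\<And>is. T is = (\<Sum>a\<in>S. c a * pure_tensor (vs a) is)"
  shows "norm (contract Bs z T) \<le> proj_norm k T * norm z"
proof -
  have *: "norm (contract Bs z T) \<le> (\<Sum>us\<leftarrow>reps. \<Prod>u\<leftarrow>us. norm u) * norm z"
    if r: "\<forall>us\<in>set reps. length us = k" "T = (\<lambda>is. \<Sum>us\<leftarrow>reps. pure_tensor us is)" for reps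
  proof -
    have "contract Bs z T = (\<Sum>us\<leftarrow>reps. apply_ops Bs z us)"
      unfolding r(2) using r(1) assms(4)
      by (subst contract_sum_list)
        (auto simp: contract_pure_tensor bil intro!: arg_cong[of _ _ sum_list])
    also have "norm \<dots> \<le> (\<Sum>us\<leftarrow>reps. norm (apply_ops Bs z us))"
      by (induction reps) (auto intro: norm_triangle_le)
    also have "\<dots> \<le> (\<Sum>us\<leftarrow>reps. (\<Prod>u\<leftarrow>us. norm u) * norm z)"
      using r(1) assms(4) by (intro sum_list_mono norm_apply_ops_le bnd) auto
    finally show ?thesis by (simp add: sum_list_mult_const)
  qed
  obtain reps where reps: "\<forall>us\<in>set reps. length us = k"
    "T = (\<lambda>is. \<Sum>us\<leftarrow>reps. pure_tensor us is)"
    using finite_sum_representation[OF assms(3,5,6,7)] by blast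
  show ?thesis
  proof (cases "z = 0")
    case True
    then show ?thesis using *[OF reps] by simp
  next
    case False
    have "norm (contract Bs z T) / norm z \<le> proj_norm k T"
      unfolding proj_norm_def
    proof (rule cInf_greatest)
      fix r assume "r \<in> {\<Sum>us\<leftarrow>reps. \<Prod>u\<leftarrow>us. norm u |reps.
        (\<forall>us\<in>set reps. length us = k) \<and> T = (\<lambda>is. \<Sum>us\<leftarrow>reps. pure_tensor us is)}"
      then show "norm (contract Bs z T) / norm z \<le> r"
        using * False by (force simp: divide_le_eq)
    qed (use reps in blast)
    then show ?thesis using False by (simp add: divide_le_eq)
  qed
qed

section \<open>Multinomial weights on multisets\<close>

definition multinomial_weight :: "('a \<Rightarrow> real) \<Rightarrow> 'a multiset \<Rightarrow> real" where
  "multinomial_weight \<rho> m =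
     fact (size m) * (\<Prod>i\<in>set_mset m. \<rho> i ^ count m i / fact (count m i))"

lemma multinomial_weight_superset:
  assumes "finite A" "set_mset m \<subseteq> A"
  shows "multinomial_weight \<rho> m = fact (size m) * (\<Prod>i\<in>A. \<rho> i ^ count m i / fact (count m i))"
  unfolding multinomial_weight_def using assms
  by (intro arg_cong2[of _ _ _ _ "(*)"] prod.mono_neutral_left) (auto simp: not_in_iff)

lemma multinomial_weight_nonneg:
  assumes "\<And>i. i \<in># m \<Longrightarrow> \<rho> i \<ge> 0"
  shows "multinomial_weight \<rho> m \<ge> 0"
  unfolding multinomial_weight_def by (intro mult_nonneg_nonneg prod_nonneg) (auto simp: assms)

lemma multinomial_weight_add_mset:
  "real (count m i + 1) * multinomial_weight \<rho> (add_mset i m)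
     = real (size m + 1) * \<rho> i * multinomial_weight \<rho> m"
proof -
  define A where "A = insert i (set_mset m)"
  define P where "P = (\<Prod>j\<in>A - {i}. \<rho> j ^ count m j / fact (count m j))"
  have A: "finite A" "i \<in> A" by (auto simp: A_def)
  have 1: "multinomial_weight \<rho> m = fact (size m) * (\<rho> i ^ count m i / fact (count m i) * P)"
    using A by (subst multinomial_weight_superset[of A])
      (auto simp: A_def P_def prod.remove[of A i for A])
  have "(\<Prod>j\<in>A - {i}. \<rho> j ^ count (add_mset i m) j / fact (count (add_mset i m) j)) = P"
    unfolding P_def by (intro prod.cong) auto
  then have 2: "multinomial_weight \<rho> (add_mset i m)
      = fact (Suc (size m)) * (\<rho> i ^ Suc (count m i) / fact (Suc (count m i)) * P)"
    using A prod.remove[OF A, of "\<lambda>j. \<rho> j ^ count (add_mset i m) j / fact (count (add_mset i m) j)"]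
    by (subst multinomial_weight_superset[of A]) (auto simp: A_def)
  show ?thesis unfolding 1 2 by (simp add: field_simps del: of_nat_Suc)
qed

text \<open>
  Multinomial laws for different numbers of draws are related by size biasing: weighting a multiset of
  size \<open>n+1\<close> by its number of letters \<open>i\<close> has the same effect as adding one letter \<open>i\<close> to a random
  multiset of size \<open>n\<close>. The total mass and the second moments follow by induction on \<open>n\<close>, without the
  multinomial theorem.
\<close>
lemma size_bias:
  assumes "finite A" "i \<in> A"
  shows "(\<Sum>m\<in>multisets_of_size A (Suc n). multinomial_weight \<rho> m * (real (count m i) * g m))
    = real (Suc n) * \<rho> i * (\<Sum>m\<in>multisets_of_size A n. multinomial_weight \<rho> m * g (add_mset i m))"
proof -
  have "(\<Sum>m\<in>multisets_of_size A (Suc n). multinomial_weight \<rho> m * (real (count m i) * g m))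
      = (\<Sum>m | m \<in> multisets_of_size A (Suc n) \<and> i \<in># m.
           multinomial_weight \<rho> m * (real (count m i) * g m))"
    using assms by (intro sum.mono_neutral_right) (auto simp: not_in_iff)
  also have "\<dots> = (\<Sum>m\<in>multisets_of_size A n. multinomial_weight \<rho> (add_mset i m) *
      (real (count m i + 1) * g (add_mset i m)))"
    by (rule sum.reindex_bij_witness[of _ "add_mset i" "\<lambda>m. m - {#i#}"])
      (use assms in \<open>auto simp: multisets_of_size_def size_Diff_singleton dest: in_diffD\<close>)
  also have "\<dots> = (\<Sum>m\<in>multisets_of_size A n. real (Suc n) * \<rho> i *
      (multinomial_weight \<rho> m * g (add_mset i m)))"
    using multinomial_weight_add_mset[of _ i \<rho>]
    by (intro sum.cong refl) (auto simp: multisets_of_size_def mult_ac)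
  finally show ?thesis by (simp add: sum_distrib_left)
qed

lemma size_eq_sum_count:
  assumes "finite A" "set_mset m \<subseteq> A"
  shows "size m = (\<Sum>i\<in>A. count m i)"
  unfolding size_multiset_overloaded_eq
  using assms by (intro sum.mono_neutral_left) (auto simp: not_in_iff)

lemma sum_multinomial_weight:
  assumes "finite A" "sum \<rho> A = 1"
  shows "(\<Sum>m\<in>multisets_of_size A n. multinomial_weight \<rho> m) = 1"
proof (induction n)
  case 0
  show ?case by (simp add: multinomial_weight_def)
next
  case (Suc n)
  have "real (Suc n) * (\<Sum>m\<in>multisets_of_size A (Suc n). multinomial_weight \<rho> m)
      = (\<Sum>m\<in>multisets_of_size A (Suc n). \<Sum>i\<in>A. multinomial_weight \<rho> m * (real (count m i) * 1))"
    unfolding sum_distrib_left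
  proof (intro sum.cong refl)
    fix m assume "m \<in> multisets_of_size A (Suc n)"
    then have "real (Suc n) = (\<Sum>i\<in>A. real (count m i))"
      using size_eq_sum_count[OF assms(1), of m] by (auto simp: multisets_of_size_def simp flip: of_nat_sum)
    then show "real (Suc n) * multinomial_weight \<rho> m
        = (\<Sum>i\<in>A. multinomial_weight \<rho> m * (real (count m i) * 1))"
      by (simp add: sum_distrib_left[symmetric] mult.commute)
  qed
  also have "\<dots> = (\<Sum>i\<in>A. \<Sum>m\<in>multisets_of_size A (Suc n). multinomial_weight \<rho> m * (real (count m i) * 1))"
    by (rule sum.swap)
  also have "\<dots> = (\<Sum>i\<in>A. real (Suc n) * \<rho> i)"
    using size_bias[OF assms(1), where n=n and \<rho>=\<rho> and g="\<lambda>_. 1"] Suc by simp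
  also have "\<dots> = real (Suc n)"
    using assms(2) by (simp add: sum_distrib_left[symmetric])
  finally show ?case by simp
qed

lemma multinomial_variance:
  assumes A: "finite A" "sum \<rho> A = 1" and "B \<subseteq> A"
  shows "(\<Sum>m\<in>multisets_of_size A n. multinomial_weight \<rho> m *
      ((\<Sum>i\<in>B. real (count m i)) - real n * sum \<rho> B)\<^sup>2) = real n * sum \<rho> B * (1 - sum \<rho> B)"
proof -
  define q where "q = sum \<rho> B"
  define K where "K m = (\<Sum>i\<in>B. real (count m i))" for m
  define E where "E n g = (\<Sum>m\<in>multisets_of_size A n. multinomial_weight \<rho> m * g m)" for n and g :: "'a multiset \<Rightarrow> real"
  have B: "finite B" using assms finite_subset by blast
  have K_add: "K (add_mset i m) = K m + 1" if "i \<in> B" for i m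
  proof -
    have "K (add_mset i m) = (\<Sum>j\<in>B. real (count m j) + (if j = i then 1 else 0))"
      unfolding K_def by (intro sum.cong) auto
    then show ?thesis using that B by (simp add: sum.distrib K_def)
  qed
  have bias: "E (Suc n) (\<lambda>m. K m * g m) = (\<Sum>i\<in>B. real (Suc n) * \<rho> i * E n (\<lambda>m. g (add_mset i m)))" for n g
  proof -
    have "E (Suc n) (\<lambda>m. K m * g m)
        = (\<Sum>m\<in>multisets_of_size A (Suc n). \<Sum>i\<in>B. multinomial_weight \<rho> m * (real (count m i) * g m))"
      by (simp add: E_def K_def sum_distrib_left sum_distrib_right)
    also have "\<dots> = (\<Sum>i\<in>B. \<Sum>m\<in>multisets_of_size A (Suc n). multinomial_weight \<rho> m * (real (count m i) * g m))"
      by (rule sum.swap)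
    also have "\<dots> = (\<Sum>i\<in>B. real (Suc n) * \<rho> i * E n (\<lambda>m. g (add_mset i m)))"
      unfolding E_def using assms by (intro sum.cong refl size_bias) auto
    finally show ?thesis .
  qed
  have E1: "E n (\<lambda>_. c) = c" for n c
    using sum_multinomial_weight[OF A, of n] by (simp add: E_def sum_distrib_right[symmetric])
  have Eadd: "E n (\<lambda>m. g m + h m) = E n g + E n h" for n g h
    by (simp add: E_def distrib_left sum.distrib)
  have Ecmult: "E n (\<lambda>m. c * g m) = c * E n g" for n c g
    by (simp add: E_def sum_distrib_left mult_ac)
  have EK: "E n K = real n * q" for n
  proof (cases n)
    case 0
    then show ?thesis by (simp add: E_def K_def)
  next
    case (Suc k)
    then show ?thesis using bias[of k "\<lambda>_. 1"] by (simp add: E1 q_def sum_distrib_left[symmetric])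
  qed
  have EK2: "E n (\<lambda>m. K m * K m) = real n * q * ((real n - 1) * q + 1)" for n
  proof (cases n)
    case 0
    then show ?thesis by (simp add: E_def K_def)
  next
    case (Suc k)
    have "E (Suc k) (\<lambda>m. K m * K m) = (\<Sum>i\<in>B. real (Suc k) * \<rho> i * E k (\<lambda>m. K m + 1))"
      unfolding bias by (intro sum.cong refl) (simp add: K_add)
    also have "\<dots> = real (Suc k) * q * (real k * q + 1)"
      by (simp add: Eadd E1 EK q_def sum_distrib_left[symmetric] sum_distrib_right[symmetric])
    finally show ?thesis using Suc by simp
  qed
  have "E n (\<lambda>m. (K m - real n * q)\<^sup>2)
      = E n (\<lambda>m. K m * K m + ((- 2 * real n * q) * K m + (real n * q)\<^sup>2))"
    by (simp add: power2_eq_square algebra_simps)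
  also have "\<dots> = real n * q * (1 - q)"
    unfolding Eadd Ecmult E1 EK EK2 by (simp add: power2_eq_square algebra_simps)
  finally show ?thesis by (simp add: E_def K_def q_def)
qed

section \<open>Infinitesimal boosts and the lower bound\<close>

definition boost :: "'a::real_inner \<Rightarrow> 'a \<times> real \<Rightarrow> 'a \<times> real" where
  "boost v z = (snd z *\<^sub>R v, inner v (fst z))"

lemma norm_boost_le: "norm (boost v z) \<le> norm v * norm z"
proof -
  have "(inner v (fst z))\<^sup>2 \<le> (norm v * norm (fst z))\<^sup>2"
    using Cauchy_Schwarz_ineq2[of v "fst z"] by (metis abs_ge_zero power2_abs power_mono)
  then have "(norm (boost v z))\<^sup>2 \<le> (norm v * norm z)\<^sup>2"
    by (simp add: boost_def norm_prod_def power_mult_distrib distrib_left)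
  then show ?thesis by (rule power2_le_imp_le) simp
qed

lemma bounded_bilinear_boost: "bounded_bilinear boost"
proof
  show "\<exists>K. \<forall>v z. norm (boost v z) \<le> norm v * norm z * K"
    using norm_boost_le by (metis mult.right_neutral)
qed (simp_all add: boost_def algebra_simps inner_add_left inner_add_right)

lemma linear_funpow:
  fixes f :: "'a::real_vector \<Rightarrow> 'a"
  assumes "linear f"
  shows "linear (f ^^ k)"
proof (induction k)
  case (Suc k)
  have "linear (f \<circ> f ^^ k)" using Suc assms by (rule linear_compose)
  then show ?case by (simp only: funpow.simps)
qed (simp add: linear_id[unfolded id_def] id_def)

lemma linear_boost_funpow: "linear (boost v ^^ k)"
  using bounded_bilinear.bounded_linear_right[OF bounded_bilinear_boost] bounded_linear.linear
    linear_funpow by blast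

lemma norm_boost_funpow_le:
  assumes "norm v = 1"
  shows "norm ((boost v ^^ k) z) \<le> norm z"
proof (induction k)
  case (Suc k)
  then show ?case using norm_boost_le[of v "(boost v ^^ k) z"] assms by simp
qed simp

text \<open>
  The spectral decomposition of \<open>boost v\<close>: eigenvectors \<open>(v, 1)\<close> and \<open>(v, -1)\<close> for the eigenvalues \<open>1\<close> and
  \<open>-1\<close>, and kernel orthogonal to both. The factor \<open>0 ^ k\<close> makes the formula correct for \<open>k = 0\<close>.
\<close>
lemma boost_funpow:
  assumes "norm v = 1"
  shows "(boost v ^^ k) z = ((inner v (fst z) + snd z) / 2) *\<^sub>R (v, 1)
      + ((-1) ^ k * ((inner v (fst z) - snd z) / 2)) *\<^sub>R (v, -1)
      + 0 ^ k *\<^sub>R (fst z - inner v (fst z) *\<^sub>R v, 0)"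
proof (induction k)
  case 0
  show ?case
    by (rule prod_eqI) (simp_all add: scaleR_add_left[symmetric] add_divide_distrib[symmetric], simp add: field_simps)
next
  case (Suc k)
  have vv: "inner v v = 1" using assms by (simp add: dot_square_norm)
  have lin: "linear (boost v)" using linear_boost_funpow[of 1 v] by simp
  have "boost v (v, 1) = (v, 1)" "boost v (v, -1) = - (v, -1)"
    "boost v (fst z - inner v (fst z) *\<^sub>R v, 0) = 0"
    by (simp_all add: boost_def vv inner_diff_right zero_prod_def)
  then show ?case
    by (simp only: funpow.simps o_apply Suc linear_add[OF lin] linear_cmul[OF lin]) simp
qed

lemma sorted_list_of_multiset_add_replicate:
  assumes "\<And>i. i \<in># m \<Longrightarrow> a \<le> i"
  shows "sorted_list_of_multiset (m + replicate_mset k a) = replicate k a @ sorted_list_of_multiset m"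
proof (induction k)
  case (Suc k)
  then show ?case using assms by (auto intro!: insort_is_Cons)
qed simp

lemma multinomial_weight_add_replicate:
  assumes "a \<notin># m"
  shows "multinomial_weight \<rho> (m + replicate_mset k a)
    = real ((size m + k) choose k) * \<rho> a ^ k * multinomial_weight \<rho> m"
proof -
  let ?m = "m + replicate_mset k a"
  have "multinomial_weight \<rho> ?m = fact (size ?m) *
      (\<Prod>i\<in>insert a (set_mset m). \<rho> i ^ count ?m i / fact (count ?m i))"
    by (rule multinomial_weight_superset) (auto split: if_splits)
  also have "(\<Prod>i\<in>insert a (set_mset m). \<rho> i ^ count ?m i / fact (count ?m i))
      = \<rho> a ^ k / fact k * (\<Prod>i\<in>set_mset m. \<rho> i ^ count m i / fact (count m i))"
  proof (subst prod.insert)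
    have "\<rho> i ^ count ?m i / fact (count ?m i) = \<rho> i ^ count m i / fact (count m i)" if "i \<in># m" for i
      using that assms by (cases "i = a") auto
    moreover have "count ?m a = k" using assms by (simp add: not_in_iff)
    ultimately show "\<rho> a ^ count ?m a / fact (count ?m a) * (\<Prod>i\<in>set_mset m. \<rho> i ^ count ?m i / fact (count ?m i))
        = \<rho> a ^ k / fact k * (\<Prod>i\<in>set_mset m. \<rho> i ^ count m i / fact (count m i))"
      by (simp cong: prod.cong_simp)
  qed (use assms in auto)
  finally show ?thesis
    by (simp add: multinomial_weight_def binomial_fact field_simps)
qed

text \<open>
  The expectation, over multinomial words with letters in \<open>A\<close>, of the composition of the operators \<open>P\<close>
  along the sorted word, applied to \<open>z\<close>.
\<close>
definition multinomial_word_sum ::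
  "('i::linorder \<Rightarrow> real) \<Rightarrow> ('i \<Rightarrow> 'z \<Rightarrow> 'z) \<Rightarrow> 'z \<Rightarrow> 'i set \<Rightarrow> nat \<Rightarrow> 'z::real_vector" where
  "multinomial_word_sum \<rho> P z A n = (\<Sum>m\<in>multisets_of_size A n.
     multinomial_weight \<rho> m *\<^sub>R foldr P (sorted_list_of_multiset m) z)"

text \<open>
  The letters equal to the minimum \<open>a\<close> stand at the front of the word, and their number is binomial.
\<close>
lemma multinomial_word_sum_insert:
  assumes A: "finite A" "\<And>i. i \<in> A \<Longrightarrow> a < i" and lin: "linear (P a)"
  shows "multinomial_word_sum \<rho> P z (insert a A) n
    = (\<Sum>k\<le>n. (real (n choose k) * \<rho> a ^ k) *\<^sub>R (P a ^^ k) (multinomial_word_sum \<rho> P z A (n - k)))"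
proof -
  have aA: "a \<notin> A" using A by auto
  note linp = linear_funpow[OF lin]
  let ?h = "\<lambda>m. multinomial_weight \<rho> m *\<^sub>R foldr P (sorted_list_of_multiset m) z"
  have "multinomial_word_sum \<rho> P z (insert a A) n
      = (\<Sum>(k, m)\<in>(SIGMA k:{0..n}. multisets_of_size A (n - k)). ?h (m + replicate_mset k a))"
    unfolding multinomial_word_sum_def
    using sum.reindex_bij_betw[OF bij_betw_multisets_of_size_insert[OF aA, of n], of ?h]
    by (simp add: case_prod_unfold)
  also have "\<dots> = (\<Sum>k\<le>n. \<Sum>m\<in>multisets_of_size A (n - k). ?h (m + replicate_mset k a))"
    using A by (subst sum.Sigma[symmetric]) (auto simp: atLeast0AtMost)
  also have "\<dots> = (\<Sum>k\<le>n. (real (n choose k) * \<rho> a ^ k) *\<^sub>R (P a ^^ k) (multinomial_word_sum \<rho> P z A (n - k)))"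
  proof (intro sum.cong refl)
    fix k assume k: "k \<in> {..n}"
    have "?h (m + replicate_mset k a)
        = (real (n choose k) * \<rho> a ^ k) *\<^sub>R (P a ^^ k) (?h m)"
      if m: "m \<in> multisets_of_size A (n - k)" for m
    proof -
      have am: "a \<notin># m" "\<And>i. i \<in># m \<Longrightarrow> a \<le> i" "size m + k = n"
        using m k A(2) aA by (auto simp: multisets_of_size_def intro: less_imp_le)
      have "foldr P (replicate k a) y = (P a ^^ k) y" for y
        by (induction k) auto
      then show ?thesis
        by (simp add: sorted_list_of_multiset_add_replicate am multinomial_weight_add_replicate
            linear_cmul[OF linp] mult_ac)
    qed
    then show "(\<Sum>m\<in>multisets_of_size A (n - k). ?h (m + replicate_mset k a))
       = (real (n choose k) * \<rho> a ^ k) *\<^sub>R (P a ^^ k) (multinomial_word_sum \<rho> P z A (n - k))"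
      by (simp add: multinomial_word_sum_def linear_sum[OF linp] scaleR_sum_right)
  qed
  finally show ?thesis .
qed

text \<open>
  In the eigenbasis of \<open>boost v\<close> the binomial theorem turns \<open>L ^ n\<close> into \<open>(L + l) ^ n\<close>, \<open>L ^ n\<close> and
  \<open>(L - l) ^ n\<close> on the eigenspaces for \<open>1\<close>, \<open>0\<close> and \<open>-1\<close>. Only the first attains the
  new rate \<open>L + l\<close>; its coefficient is the projection of \<open>(u, 1)\<close> to the line through \<open>(v, 1)\<close>. The old
  error grows at most at rate \<open>r + l < L + l\<close>.
\<close>
lemma boost_binomial_step:
  fixes u v :: "'a::real_inner"
  assumes v: "norm v = 1" and l: "l > 0" and r: "0 \<le> r" "r < L" and C: "C \<ge> 0"
    and H: "\<And>n. norm (H n - (c * L ^ n) *\<^sub>R (u, 1)) \<le> C * r ^ n"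
    and G: "\<And>n. G n = (\<Sum>k\<le>n. (real (n choose k) * l ^ k) *\<^sub>R (boost v ^^ k) (H (n - k)))"
  shows "\<exists>C'\<ge>0. \<exists>r'\<ge>0. r' < L + l \<and>
    (\<forall>n. norm (G n - (c * (1 + inner v u) / 2 * (L + l) ^ n) *\<^sub>R (v, 1)) \<le> C' * r' ^ n)"
proof -
  define R where "R n = H n - (c * L ^ n) *\<^sub>R (u, 1::real)" for n
  define \<beta> where "\<beta> = (inner v u - 1) / 2"
  define y where "y = (u - inner v u *\<^sub>R v, 0::real)"
  have binom: "(\<Sum>k\<le>n. real (n choose k) * l ^ k * (c * L ^ (n - k)) * x ^ k) = c * (x * l + L) ^ n" for x n
    unfolding binomial_ring sum_distrib_left power_mult_distrib
    by (intro sum.cong) (auto simp: mult_ac)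
  have main: "(\<Sum>k\<le>n. (real (n choose k) * l ^ k) *\<^sub>R (boost v ^^ k) ((c * L ^ (n - k)) *\<^sub>R (u, 1)))
      = (c * (1 + inner v u) / 2 * (L + l) ^ n) *\<^sub>R (v, 1)
        + (c * \<beta> * (L - l) ^ n) *\<^sub>R (v, -1) + (c * L ^ n) *\<^sub>R y" for n
  proof -
    have step: "(boost v ^^ k) (u, 1) = ((1 + inner v u) / 2) *\<^sub>R (v, 1) + ((-1) ^ k * \<beta>) *\<^sub>R (v, -1) + 0 ^ k *\<^sub>R y" for k
      using boost_funpow[OF v, of k "(u, 1)"] by (simp add: \<beta>_def y_def add.commute[of 1])
    have dist: "N *\<^sub>R X *\<^sub>R (a *\<^sub>R p + (e * b) *\<^sub>R q + o' *\<^sub>R w)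
        = (N * X * 1) *\<^sub>R a *\<^sub>R p + (N * X * e) *\<^sub>R b *\<^sub>R q + (N * X * o') *\<^sub>R w"
      for N X a e b o' :: real and p q w :: "'a \<times> real"
      by (simp add: scaleR_add_right mult_ac)
    have "(real (n choose k) * l ^ k) *\<^sub>R (boost v ^^ k) ((c * L ^ (n - k)) *\<^sub>R (u, 1))
      = (real (n choose k) * l ^ k * (c * L ^ (n - k)) * 1 ^ k) *\<^sub>R (((1 + inner v u) / 2) *\<^sub>R (v, 1))
       + (real (n choose k) * l ^ k * (c * L ^ (n - k)) * (-1) ^ k) *\<^sub>R (\<beta> *\<^sub>R (v, -1))
       + (real (n choose k) * l ^ k * (c * L ^ (n - k)) * 0 ^ k) *\<^sub>R y" for k
      unfolding linear_cmul[OF linear_boost_funpow] step power_one by (rule dist)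
    then have "(\<Sum>k\<le>n. (real (n choose k) * l ^ k) *\<^sub>R (boost v ^^ k) ((c * L ^ (n - k)) *\<^sub>R (u, 1)))
      = (c * (1 * l + L) ^ n) *\<^sub>R (((1 + inner v u) / 2) *\<^sub>R (v, 1))
       + (c * (-1 * l + L) ^ n) *\<^sub>R (\<beta> *\<^sub>R (v, -1)) + (c * (0 * l + L) ^ n) *\<^sub>R y"
      by (simp only: sum.distrib scaleR_sum_left[symmetric] binom)
    then show ?thesis by (simp add: algebra_simps)
  qed
  have G2: "G n = (c * (1 + inner v u) / 2 * (L + l) ^ n) *\<^sub>R (v, 1)
        + (c * \<beta> * (L - l) ^ n) *\<^sub>R (v, -1) + (c * L ^ n) *\<^sub>R y
        + (\<Sum>k\<le>n. (real (n choose k) * l ^ k) *\<^sub>R (boost v ^^ k) (R (n - k)))" for n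
  proof -
    have "H j = (c * L ^ j) *\<^sub>R (u, 1) + R j" for j by (simp add: R_def)
    then show ?thesis
      unfolding G main[symmetric] sum.distrib[symmetric]
      by (simp only: linear_add[OF linear_boost_funpow] scaleR_add_right)
  qed
  have rem: "norm (\<Sum>k\<le>n. (real (n choose k) * l ^ k) *\<^sub>R (boost v ^^ k) (R (n - k))) \<le> C * (l + r) ^ n" for n
  proof -
    have "norm (\<Sum>k\<le>n. (real (n choose k) * l ^ k) *\<^sub>R (boost v ^^ k) (R (n - k)))
        \<le> (\<Sum>k\<le>n. real (n choose k) * l ^ k * (C * r ^ (n - k)))"
    proof (intro sum_norm_le)
      fix k
      have "norm ((boost v ^^ k) (R (n - k))) \<le> C * r ^ (n - k)"
        using norm_boost_funpow_le[OF v, of k "R (n - k)"] H[of "n - k"] by (simp add: R_def)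
      then show "norm ((real (n choose k) * l ^ k) *\<^sub>R (boost v ^^ k) (R (n - k)))
          \<le> real (n choose k) * l ^ k * (C * r ^ (n - k))"
        using l by (simp add: abs_mult mult_left_mono)
    qed
    also have "\<dots> = C * (l + r) ^ n"
      by (simp add: binomial_ring[of l r n] sum_distrib_left mult_ac)
    finally show ?thesis .
  qed
  define r' where "r' = Max {\<bar>L - l\<bar>, L, l + r}"
  have r': "\<bar>L - l\<bar> \<le> r'" "L \<le> r'" "l + r \<le> r'" "r' < L + l"
    using r l by (auto simp: r'_def)
  define C' where "C' = \<bar>c * \<beta>\<bar> * norm (v, -1::real) + \<bar>c\<bar> * norm y + C"
  have "norm (G n - (c * (1 + inner v u) / 2 * (L + l) ^ n) *\<^sub>R (v, 1)) \<le> C' * r' ^ n" for n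
  proof -
    have "norm (G n - (c * (1 + inner v u) / 2 * (L + l) ^ n) *\<^sub>R (v, 1))
        \<le> norm ((c * \<beta> * (L - l) ^ n) *\<^sub>R (v, -1::real)) + norm ((c * L ^ n) *\<^sub>R y) + C * (l + r) ^ n"
      unfolding G2 using rem[of n] by (simp only: add_diff_cancel_left' add.assoc)
        (intro norm_triangle_le add_left_mono order.trans[OF norm_triangle_ineq], simp)
    also have "norm ((c * \<beta> * (L - l) ^ n) *\<^sub>R (v, -1::real)) = \<bar>c * \<beta>\<bar> * norm (v, -1::real) * \<bar>L - l\<bar> ^ n"
      by (simp only: norm_scaleR abs_mult power_abs real_norm_def mult_ac)
    also have "norm ((c * L ^ n) *\<^sub>R y) = \<bar>c\<bar> * norm y * L ^ n"
      using r by (simp add: abs_mult)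
    also have "\<bar>c * \<beta>\<bar> * norm (v, -1::real) * \<bar>L - l\<bar> ^ n + \<bar>c\<bar> * norm y * L ^ n + C * (l + r) ^ n
        \<le> \<bar>c * \<beta>\<bar> * norm (v, -1::real) * r' ^ n + \<bar>c\<bar> * norm y * r' ^ n + C * r' ^ n"
      using r' r l C by (intro add_mono mult_left_mono power_mono) auto
    finally show ?thesis by (simp add: C'_def distrib_right)
  qed
  moreover have "C' \<ge> 0" "r' \<ge> 0" using C r r' by (auto simp: C'_def)
  ultimately show ?thesis using r' by blast
qed

text \<open>
  Segments are prepended one at a time, starting from the last. The start vector \<open>(v (M - 1), 1)\<close> is
  fixed by the boost of the last segment, so that the induction starts without an error term.
\<close>
lemma boost_word_sum_asymptotics:
  fixes v :: "nat \<Rightarrow> 'a::real_inner"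
  assumes v: "\<And>i. i < M \<Longrightarrow> norm (v i) = 1"
    and turn: "\<And>i. Suc i < M \<Longrightarrow> inner (v i) (v (Suc i)) > -1"
    and l: "\<And>i. i < M \<Longrightarrow> l i > 0"
    and a: "a \<le> M - 1" and M: "M > 0"
  shows "\<exists>c>0. \<exists>C\<ge>0. \<exists>r\<ge>0. r < sum l {a..<M} \<and> (\<forall>n.
    norm (multinomial_word_sum l (\<lambda>i. boost (v i)) (v (M - 1), 1) {a..<M} n
      - (c * (sum l {a..<M}) ^ n) *\<^sub>R (v a, 1)) \<le> C * r ^ n)"
  using a
proof (induction a rule: inc_induct)
  have lin: "linear (boost (v i))" for i
    using linear_boost_funpow[of 1 "v i"] by simp
  {
    case base
    let ?z = "(v (M - 1), 1::real)"
    have set: "{M - 1..<M} = insert (M - 1) {}" using M by auto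
    have H: "multinomial_word_sum l (\<lambda>i. boost (v i)) ?z {} n = (if n = 0 then ?z else 0)" for n
      by (simp add: multinomial_word_sum_def multinomial_weight_def)
    have fix_z: "(boost (v (M - 1)) ^^ n) ?z = ?z" for n
      using M v[of "M - 1"] by (simp add: boost_funpow dot_square_norm)
    have "multinomial_word_sum l (\<lambda>i. boost (v i)) ?z {M - 1..<M} n = l (M - 1) ^ n *\<^sub>R ?z" for n
    proof -
      have "multinomial_word_sum l (\<lambda>i. boost (v i)) ?z {M - 1..<M} n
          = (\<Sum>k\<le>n. (real (n choose k) * l (M - 1) ^ k) *\<^sub>R (boost (v (M - 1)) ^^ k) (if n - k = 0 then ?z else 0))"
        unfolding set H[symmetric] by (rule multinomial_word_sum_insert) (auto simp: lin)
      also have "\<dots> = (\<Sum>k\<in>{n}. (real (n choose k) * l (M - 1) ^ k) *\<^sub>R (boost (v (M - 1)) ^^ k) (if n - k = 0 then ?z else 0))"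
        by (intro sum.mono_neutral_right) (auto simp: linear_0[OF linear_boost_funpow])
      finally show ?thesis by (simp add: fix_z del: One_nat_def scaleR_Pair)
    qed
    then show ?case
      using l[of "M - 1"] M unfolding set by (intro exI[of _ 1] conjI exI[of _ 0]) auto
  next
    case (step a)
    then obtain c C r where IH: "c > 0" "C \<ge> 0" "r \<ge> 0" "r < sum l {Suc a..<M}"
      "\<And>n. norm (multinomial_word_sum l (\<lambda>i. boost (v i)) (v (M - 1), 1) {Suc a..<M} n
        - (c * (sum l {Suc a..<M}) ^ n) *\<^sub>R (v (Suc a), 1)) \<le> C * r ^ n" by blast
    have aM: "Suc a < M" using step by auto
    then have set: "{a..<M} = insert a {Suc a..<M}" by auto
    have L: "sum l {a..<M} = sum l {Suc a..<M} + l a" unfolding set by simp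
    obtain C' r' where "C' \<ge> 0" "r' \<ge> 0" "r' < sum l {a..<M}"
      "\<And>n. norm (multinomial_word_sum l (\<lambda>i. boost (v i)) (v (M - 1), 1) {a..<M} n
        - (c * (1 + inner (v a) (v (Suc a))) / 2 * (sum l {a..<M}) ^ n) *\<^sub>R (v a, 1)) \<le> C' * r' ^ n"
      unfolding L
      using boost_binomial_step[of "v a" "l a" r "sum l {Suc a..<M}" C _ c "v (Suc a)"
          "multinomial_word_sum l (\<lambda>i. boost (v i)) (v (M - 1), 1) {a..<M}", OF _ _ IH(3,4,2,5)]
        v[of a] l[of a] aM multinomial_word_sum_insert[of "{Suc a..<M}" a "\<lambda>i. boost (v i)" l "(v (M - 1), 1)"] lin[of a]
      unfolding set by auto
    then show ?case
      using IH(1) turn[OF aM]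
      by (intro exI[of _ "c * (1 + inner (v a) (v (Suc a))) / 2"] conjI exI[of _ C'] exI[of _ r']) auto
  }
qed

lemma boost_word_sum_bounded_below:
  fixes v :: "nat \<Rightarrow> 'a::real_inner"
  assumes v: "\<And>i. i < M \<Longrightarrow> norm (v i) = 1"
    and turn: "\<And>i. Suc i < M \<Longrightarrow> inner (v i) (v (Suc i)) > -1"
    and l: "\<And>i. i < M \<Longrightarrow> l i > 0" and l1: "sum l {..<M} = 1"
  shows "\<exists>\<delta>>0. eventually (\<lambda>n.
    \<delta> \<le> norm (multinomial_word_sum l (\<lambda>i. boost (v i)) (v (M - 1), 1) {..<M} n)) sequentially"
proof -
  have M: "M > 0" using l1 by (cases M) auto
  let ?G = "multinomial_word_sum l (\<lambda>i. boost (v i)) (v (M - 1), 1) {..<M}"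
  obtain c C r where c: "c > 0" "r \<ge> 0" "r < 1"
    "\<And>n. norm (?G n - c *\<^sub>R (v 0, 1)) \<le> C * r ^ n"
    using boost_word_sum_asymptotics[of M v l 0, OF v turn l _ M] l1 by (auto simp: atLeast0LessThan)
  have "(\<lambda>n. C * r ^ n) \<longlonglongrightarrow> 0"
    using c by (intro tendsto_mult_right_zero LIMSEQ_realpow_zero)
  then have "(\<lambda>n. ?G n - c *\<^sub>R (v 0, 1)) \<longlonglongrightarrow> 0"
    by (rule Lim_null_comparison[rotated]) (use c(4) in \<open>auto intro: always_eventually\<close>)
  then have "?G \<longlonglongrightarrow> c *\<^sub>R (v 0, 1)" by (simp add: LIM_zero_iff)
  then have lim: "(\<lambda>n. norm (?G n)) \<longlonglongrightarrow> norm (c *\<^sub>R (v 0, 1::real))" by (rule tendsto_norm)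
  have "norm (c *\<^sub>R (v 0, 1::real)) > 0" using c(1) by (simp add: zero_prod_def)
  then obtain \<delta> where "0 < \<delta>" "\<delta> < norm (c *\<^sub>R (v 0, 1::real))" using dense by blast
  then show ?thesis
    using order_tendstoD(1)[OF lim] by (metis (no_types, lifting) eventually_mono less_imp_le)
qed

section \<open>Simplex integrals of step functions\<close>

locale time_partition =
  fixes M :: nat and \<tau> :: "nat \<Rightarrow> real"
  assumes \<tau>_0: "\<tau> 0 = 0" and \<tau>_M: "\<tau> M = 1"
    and \<tau>_less_Suc: "\<And>i. i < M \<Longrightarrow> \<tau> i < \<tau> (Suc i)"
begin

definition gap :: "nat \<Rightarrow> real" where "gap i = \<tau> (Suc i) - \<tau> i"

definition cell :: "nat \<Rightarrow> real set" where "cell i = {\<tau> i<..<\<tau> (Suc i)}"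

lemma gap_pos: "i < M \<Longrightarrow> gap i > 0"
  using \<tau>_less_Suc by (simp add: gap_def)

lemma sum_gap_lessThan: "sum gap {..<i} = \<tau> i"
  unfolding gap_def by (simp add: sum_lessThan_telescope \<tau>_0)

lemma sum_gap: "sum gap {..<M} = 1"
  by (simp add: sum_gap_lessThan \<tau>_M)

lemma \<tau>_mono: "i \<le> j \<Longrightarrow> j \<le> M \<Longrightarrow> \<tau> i \<le> \<tau> j"
proof (induction j rule: dec_induct)
  case (step j)
  then show ?case using \<tau>_less_Suc[of j] by simp
qed simp

lemma cell_subset: "i < M \<Longrightarrow> cell i \<subseteq> {0<..<1}"
  using \<tau>_mono[of 0 i] \<tau>_mono[of "Suc i" M] by (auto simp: cell_def \<tau>_0 \<tau>_M)

lemma cell_inj: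
  assumes "t \<in> cell i" "t \<in> cell j" "i < M" "j < M"
  shows "i = j"
proof (rule ccontr)
  assume "i \<noteq> j"
  then consider "Suc i \<le> j" | "Suc j \<le> i" by linarith
  then show False
    using \<tau>_mono[of "Suc i" j] \<tau>_mono[of "Suc j" i] assms by cases (auto simp: cell_def)
qed

lemma cell_exists:
  assumes "t \<in> {0<..<1}" "t \<notin> \<tau> ` {..M}"
  shows "\<exists>i<M. t \<in> cell i"
proof -
  define i where "i = (LEAST j. t < \<tau> j)"
  have ex: "t < \<tau> M" using assms by (simp add: \<tau>_M)
  have i: "t < \<tau> i" "i \<le> M" unfolding i_def by (rule LeastI, rule ex, rule Least_le, rule ex)
  then obtain k where k: "i = Suc k" using assms by (cases i) (auto simp: \<tau>_0)
  then have "\<not> t < \<tau> k" using not_less_Least[of k "\<lambda>j. t < \<tau> j"] by (simp add: i_def)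
  moreover have "t \<noteq> \<tau> k" using assms i k by auto
  ultimately show ?thesis using i k by (intro exI[of _ k]) (auto simp: cell_def)
qed

text \<open>
  The increasing tuples below \<open>t\<close> whose \<open>j\<close>-th entry lies in the cell of the \<open>j\<close>-th letter. Letters are
  counted from \<open>0\<close>, coordinates from \<open>1\<close>. The bound \<open>t\<close> is the variable of the recursion that peels off
  the last coordinate.
\<close>
definition word_cell :: "nat list \<Rightarrow> real \<Rightarrow> (nat \<Rightarrow> real) set" where
  "word_cell w t = {u \<in> space (Pi\<^sub>M {1..length w} (\<lambda>_. lborel)).
     (\<forall>j\<in>{1..length w}. u j \<in> cell (w ! (j - 1)) \<and> u j < t) \<and>
     (\<forall>i\<in>{1..length w}. \<forall>j\<in>{1..length w}. i < j \<longrightarrow> u i < u j)}"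

definition clamped_gap :: "nat \<Rightarrow> real \<Rightarrow> real" where
  "clamped_gap i t = max 0 (min t (\<tau> (Suc i)) - \<tau> i)"

text \<open>
  Points in different cells are ordered automatically, so a cell with \<open>k\<close> points contributes a
  \<open>k\<close>-dimensional simplex of side \<open>clamped_gap\<close>, with volume that side to the power \<open>k\<close> divided by \<open>k!\<close>.
\<close>
definition word_volume :: "nat list \<Rightarrow> real \<Rightarrow> real" where
  "word_volume w t = (if sorted w
     then \<Prod>i<M. clamped_gap i t ^ count (mset w) i / fact (count (mset w) i) else 0)"

lemma sets_word_cell [measurable]: "word_cell w t \<in> sets (Pi\<^sub>M {1..length w} (\<lambda>_. lborel))"
  unfolding word_cell_def cell_def greaterThanLessThan_iff
  by measurable

lemma word_cell_snoc:
  assumes "x \<in> space (Pi\<^sub>M {1..length w} (\<lambda>_. lborel))"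
  shows "x(Suc (length w) := y) \<in> word_cell (w @ [i]) t
    \<longleftrightarrow> y \<in> cell i \<and> y < t \<and> x \<in> word_cell w y"
proof -
  let ?n = "length w"
  have sp: "x(Suc ?n := y) \<in> space (Pi\<^sub>M {1..Suc ?n} (\<lambda>_. lborel))"
    using assms by (auto simp: space_PiM PiE_def extensional_def)
  have set: "{1..Suc ?n} = insert (Suc ?n) {1..?n}" by auto
  have nth: "(w @ [i]) ! (j - 1) = w ! (j - 1)" if "j \<in> {1..?n}" for j
    using that by (auto simp: nth_append)
  have 1: "(\<forall>j\<in>{1..Suc ?n}. (x(Suc ?n := y)) j \<in> cell ((w @ [i]) ! (j - 1)) \<and> (x(Suc ?n := y)) j < t)
      \<longleftrightarrow> y \<in> cell i \<and> y < t \<and> (\<forall>j\<in>{1..?n}. x j \<in> cell (w ! (j - 1)) \<and> x j < t)"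
    unfolding set using nth by auto
  have 2: "(\<forall>i\<in>{1..Suc ?n}. \<forall>j\<in>{1..Suc ?n}. i < j \<longrightarrow> (x(Suc ?n := y)) i < (x(Suc ?n := y)) j)
      \<longleftrightarrow> (\<forall>j\<in>{1..?n}. x j < y) \<and> (\<forall>i\<in>{1..?n}. \<forall>j\<in>{1..?n}. i < j \<longrightarrow> x i < x j)"
    unfolding set by auto
  have 3: "u \<in> word_cell (w @ [i]) t \<longleftrightarrow> u \<in> space (Pi\<^sub>M {1..Suc ?n} (\<lambda>_. lborel)) \<and>
     (\<forall>j\<in>{1..Suc ?n}. u j \<in> cell ((w @ [i]) ! (j - 1)) \<and> u j < t) \<and>
     (\<forall>i\<in>{1..Suc ?n}. \<forall>j\<in>{1..Suc ?n}. i < j \<longrightarrow> u i < u j)" for u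
    by (simp add: word_cell_def)
  show ?thesis
    unfolding 3 1 2 using sp assms by (auto simp: word_cell_def intro: less_trans)
qed

lemma nn_integral_shifted_power:
  assumes "a \<le> b" "K \<ge> 0"
  shows "(\<integral>\<^sup>+y. ennreal (K * ((y - a) ^ k / fact k)) * indicator {a<..<b} y \<partial>lborel)
    = ennreal (K * ((b - a) ^ Suc k / fact (Suc k)))"
proof -
  have "(\<integral>\<^sup>+y. ennreal (K * ((y - a) ^ k / fact k)) * indicator {a<..<b} y \<partial>lborel)
      = (\<integral>\<^sup>+y. ennreal (K * ((y - a) ^ k / fact k)) * indicator {a..b} y \<partial>lborel)"
  proof (rule nn_integral_cong_AE)
    show "AE y in lborel. ennreal (K * ((y - a) ^ k / fact k)) * indicator {a<..<b} y
        = ennreal (K * ((y - a) ^ k / fact k)) * indicator {a..b} y"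
      using AE_lborel_singleton[of a] AE_lborel_singleton[of b]
      by eventually_elim (auto simp: indicator_def)
  qed
  also have "\<dots> = ennreal (K * ((b - a) ^ Suc k / fact (Suc k)) - K * ((a - a) ^ Suc k / fact (Suc k)))"
  proof (rule nn_integral_FTC_Icc)
    fix y
    have "((\<lambda>y. K * ((y - a) ^ Suc k / fact (Suc k))) has_real_derivative
        K * (real (Suc k) * (y - a) ^ k / fact (Suc k))) (at y)"
      by (auto intro!: derivative_eq_intros simp del: fact_Suc power_Suc of_nat_Suc)
    moreover have "real (Suc k) * (y - a) ^ k / fact (Suc k) = (y - a) ^ k / fact k"
      by (simp del: of_nat_Suc)
    ultimately show "((\<lambda>y. K * ((y - a) ^ Suc k / fact (Suc k))) has_real_derivative
        K * ((y - a) ^ k / fact k)) (at y)" by simp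
  qed (use assms in auto)
  finally show ?thesis by simp
qed

text \<open>
  On cell \<open>i\<close> only the factor of the letter \<open>i\<close> depends on \<open>y\<close>: smaller letters have full cells, larger
  ones empty cells. If a letter of \<open>w\<close> exceeds \<open>i\<close>, its empty cell makes the integrand vanish.
\<close>
lemma word_volume_snoc:
  assumes w: "set w \<subseteq> {..<M}" and i: "i < M"
  shows "(\<integral>\<^sup>+y. ennreal (word_volume w y) * indicator (cell i \<inter> {..<t}) y \<partial>lborel)
    = ennreal (word_volume (w @ [i]) t)"
proof (cases "sorted (w @ [i])")
  case False
  have zero: "word_volume w y = 0" if y: "y \<in> cell i" for y
  proof (cases "sorted w")
    case True
    then obtain x where x: "x \<in> set w" "i < x" using False by (auto simp: sorted_append not_le)
    then have "y \<le> \<tau> x" "x < M" using w y \<tau>_mono[of "Suc i" x] by (auto simp: cell_def)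
    then have "clamped_gap x y ^ count (mset w) x = 0"
      using x by (simp add: clamped_gap_def count_eq_zero_iff)
    then show ?thesis using \<open>x < M\<close> by (auto simp: word_volume_def intro!: prod_zero)
  qed (simp add: word_volume_def)
  have "(\<integral>\<^sup>+y. ennreal (word_volume w y) * indicator (cell i \<inter> {..<t}) y \<partial>lborel) = (\<integral>\<^sup>+y. 0 \<partial>(lborel :: real measure))"
    by (intro nn_integral_cong) (auto simp: indicator_def zero)
  then show ?thesis using False by (simp add: word_volume_def)
next
  case True
  then have sw: "sorted w" "\<And>j. i < j \<Longrightarrow> count (mset w) j = 0"
    by (auto simp: sorted_append not_in_iff[symmetric])
  define k where "k = count (mset w) i"
  define K where "K = (\<Prod>j\<in>{..<M}-{i}. gap j ^ count (mset w) j / fact (count (mset w) j))"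
  have K: "K \<ge> 0" unfolding K_def
    by (intro prod_nonneg ballI divide_nonneg_nonneg zero_le_power) (auto intro: less_imp_le gap_pos)
  have clamp: "clamped_gap j y = gap j" if "\<tau> i < y" "j < i" for j y
    using that i \<tau>_mono[of "Suc j" i] \<tau>_less_Suc[of j] by (auto simp: clamped_gap_def gap_def)
  have rest: "(\<Prod>j\<in>{..<M}-{i}. clamped_gap j y ^ count (mset w) j / fact (count (mset w) j)) = K"
    if "\<tau> i < y" for y
    unfolding K_def
  proof (intro prod.cong refl)
    fix j assume "j \<in> {..<M} - {i}"
    then consider "j < i" | "i < j" by fastforce
    then show "clamped_gap j y ^ count (mset w) j / fact (count (mset w) j)
        = gap j ^ count (mset w) j / fact (count (mset w) j)"
    proof cases
      case 1
      then show ?thesis using clamp[OF that] by simp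
    next
      case 2
      then have c: "count (mset w) j = 0" by (rule sw(2))
      show ?thesis unfolding c by simp
    qed
  qed
  define s where "s = max (\<tau> i) (min t (\<tau> (Suc i)))"
  have "(\<integral>\<^sup>+y. ennreal (word_volume w y) * indicator (cell i \<inter> {..<t}) y \<partial>lborel)
      = (\<integral>\<^sup>+y. ennreal (K * ((y - \<tau> i) ^ k / fact k)) * indicator {\<tau> i<..<s} y \<partial>lborel)"
  proof (rule nn_integral_cong)
    fix y :: real
    show "ennreal (word_volume w y) * indicator (cell i \<inter> {..<t}) y
        = ennreal (K * ((y - \<tau> i) ^ k / fact k)) * indicator {\<tau> i<..<s} y"
    proof (cases "y \<in> cell i \<inter> {..<t}")
      case True
      then have y: "\<tau> i < y" "y < \<tau> (Suc i)" "y < t" by (auto simp: cell_def)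
      have "word_volume w y = (y - \<tau> i) ^ k / fact k * K"
        using y sw i rest[OF y(1)] by (simp add: word_volume_def prod.remove[of _ i] k_def clamped_gap_def)
      then show ?thesis using True y by (simp add: s_def mult.commute)
    next
      case False
      then have "y \<notin> {\<tau> i<..<s}" by (auto simp: s_def cell_def)
      then show ?thesis using False by simp
    qed
  qed
  also have "\<dots> = ennreal (K * ((s - \<tau> i) ^ Suc k / fact (Suc k)))"
    by (rule nn_integral_shifted_power) (auto simp: s_def K)
  also have "K * ((s - \<tau> i) ^ Suc k / fact (Suc k)) = word_volume (w @ [i]) t"
  proof (cases "\<tau> i < t")
    case t: True
    have "(\<Prod>j\<in>{..<M}-{i}. clamped_gap j t ^ count (mset (w @ [i])) j / fact (count (mset (w @ [i])) j)) = K"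
      unfolding rest[OF t, symmetric] by (intro prod.cong) auto
    moreover have "clamped_gap i t = s - \<tau> i" using \<tau>_less_Suc[OF i] by (auto simp: s_def clamped_gap_def)
    moreover have "count (mset (w @ [i])) i = Suc k" by (simp add: k_def)
    ultimately show ?thesis using True i
      by (simp add: word_volume_def prod.remove[of _ i] k_def mult.commute del: mset_append fact_Suc)
  next
    case t: False
    then have "s = \<tau> i" "clamped_gap i t = 0" by (auto simp: s_def clamped_gap_def)
    then show ?thesis using True i by (simp add: word_volume_def prod.remove[of _ i])
  qed
  finally show ?thesis .
qed

lemma emeasure_word_cell:
  assumes "set w \<subseteq> {..<M}"
  shows "emeasure (Pi\<^sub>M {1..length w} (\<lambda>_. lborel)) (word_cell w t) = ennreal (word_volume w t)"
  using assms
proof (induction w arbitrary: t rule: rev_induct)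
  case Nil
  have "word_cell [] t = {\<lambda>_. undefined}" by (auto simp: word_cell_def space_PiM)
  then show ?case by (simp add: word_volume_def emeasure_PiM_empty)
next
  case (snoc i w)
  interpret product_sigma_finite "\<lambda>_::nat. lborel :: real measure"
    by (rule product_sigma_finite.intro) (rule lborel.sigma_finite_measure_axioms)
  let ?n = "length w"
  have set: "{1..Suc ?n} = insert (Suc ?n) {1..?n}" by auto
  have meas: "word_cell (w @ [i]) t \<in> sets (Pi\<^sub>M (insert (Suc ?n) {1..?n}) (\<lambda>_. lborel))"
    using sets_word_cell[of "w @ [i]" t] unfolding set[symmetric] by simp
  have "emeasure (Pi\<^sub>M {1..length (w @ [i])} (\<lambda>_. lborel)) (word_cell (w @ [i]) t)
      = (\<integral>\<^sup>+u. indicator (word_cell (w @ [i]) t) u \<partial>Pi\<^sub>M (insert (Suc ?n) {1..?n}) (\<lambda>_. lborel))"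
    using meas unfolding set[symmetric] by simp
  also have "\<dots> = (\<integral>\<^sup>+y. (\<integral>\<^sup>+x. indicator (word_cell (w @ [i]) t) (x(Suc ?n := y)) \<partial>Pi\<^sub>M {1..?n} (\<lambda>_. lborel)) \<partial>lborel)"
    using meas by (intro product_nn_integral_insert_rev) auto
  also have "\<dots> = (\<integral>\<^sup>+y. ennreal (word_volume w y) * indicator (cell i \<inter> {..<t}) y \<partial>lborel)"
  proof (rule nn_integral_cong)
    fix y
    have "(\<integral>\<^sup>+x. indicator (word_cell (w @ [i]) t) (x(Suc ?n := y)) \<partial>Pi\<^sub>M {1..?n} (\<lambda>_. lborel))
        = (\<integral>\<^sup>+x. indicator (cell i \<inter> {..<t}) y * indicator (word_cell w y) x \<partial>Pi\<^sub>M {1..?n} (\<lambda>_. lborel))"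
      by (intro nn_integral_cong) (auto simp: word_cell_snoc indicator_def)
    also have "\<dots> = indicator (cell i \<inter> {..<t}) y * emeasure (Pi\<^sub>M {1..?n} (\<lambda>_. lborel)) (word_cell w y)"
      by (rule nn_integral_cmult_indicator) (rule sets_word_cell)
    finally show "(\<integral>\<^sup>+x. indicator (word_cell (w @ [i]) t) (x(Suc ?n := y)) \<partial>Pi\<^sub>M {1..?n} (\<lambda>_. lborel))
        = ennreal (word_volume w y) * indicator (cell i \<inter> {..<t}) y"
      using snoc by (simp add: mult.commute)
  qed
  also have "\<dots> = ennreal (word_volume (w @ [i]) t)"
    using snoc.prems by (intro word_volume_snoc) auto
  finally show ?case .
qed

end

lemma AE_PiM_lborel_notin_finite:
  fixes N :: "real set"
  assumes "finite I" "finite N"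
  shows "AE u in Pi\<^sub>M I (\<lambda>_. lborel). \<forall>j\<in>I. u j \<notin> N"
proof -
  interpret product_sigma_finite "\<lambda>_. lborel :: real measure"
    by (rule product_sigma_finite.intro) (rule lborel.sigma_finite_measure_axioms)
  have "AE u in Pi\<^sub>M I (\<lambda>_. lborel). u j \<notin> N" if j: "j \<in> I" for j
  proof (rule AE_I)
    let ?A = "\<lambda>i. if i = j then N else UNIV :: real set"
    have N: "N \<in> sets borel" using assms(2) by (simp add: finite_imp_closed borel_closed)
    show "{u \<in> space (Pi\<^sub>M I (\<lambda>_. lborel)). \<not> u j \<notin> N} \<subseteq> Pi\<^sub>E I ?A"
      by (auto simp: space_PiM PiE_iff extensional_def)
    show "Pi\<^sub>E I ?A \<in> sets (Pi\<^sub>M I (\<lambda>_. lborel))"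
      using assms N by (intro sets_PiM_I_finite) auto
    have "emeasure lborel N = 0" using assms(2) by (simp add: emeasure_lborel_countable uncountable_infinite countable_finite)
    then have "(\<Prod>i\<in>I. emeasure lborel (?A i)) = 0"
      using assms(1) j by (intro prod_zero) auto
    then show "emeasure (Pi\<^sub>M I (\<lambda>_. lborel)) (Pi\<^sub>E I ?A) = 0"
      using assms N by (subst emeasure_PiM) auto
  qed
  then show ?thesis by (intro AE_finite_allI assms)
qed

lemma space_PiM_lborel: "space (Pi\<^sub>M I (\<lambda>_. lborel)) = I \<rightarrow>\<^sub>E UNIV"
  by (simp add: space_PiM)

lemma sets_open_simplex [measurable]: "open_simplex n \<in> sets (Pi\<^sub>M {1..n} (\<lambda>_. lborel))"
proof -
  have "{u \<in> space (Pi\<^sub>M {1..n} (\<lambda>_. lborel)). (\<forall>i\<in>{1..n}. 0 < u i \<and> u i < 1) \<and>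
     (\<forall>i\<in>{1..n}. \<forall>j\<in>{1..n}. i < j \<longrightarrow> u i < u j)} \<in> sets (Pi\<^sub>M {1..n} (\<lambda>_. lborel :: real measure))"
    by measurable
  then show ?thesis by (simp add: open_simplex_def space_PiM_lborel)
qed

context time_partition
begin

lemma word_volume_one:
  assumes "set w \<subseteq> {..<M}" "sorted w"
  shows "fact (length w) * word_volume w 1 = multinomial_weight gap (mset w)"
proof -
  have "clamped_gap i 1 = gap i" if "i < M" for i
    using that \<tau>_mono[of "Suc i" M] \<tau>_less_Suc[OF that] by (simp add: clamped_gap_def gap_def \<tau>_M)
  then show ?thesis
    using assms by (subst multinomial_weight_superset[of "{..<M}"]) (auto simp: word_volume_def)
qed

lemma f_finite_range_measurable:
  fixes f :: "real \<Rightarrow> 'a"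
  assumes f: "\<And>i t. i < M \<Longrightarrow> t \<in> cell i \<Longrightarrow> f t = v i"
  shows "{t \<in> {0<..<1}. f t = y} \<in> sets borel"
proof -
  have "{t \<in> {0<..<1}. f t = y}
      = (\<Union>i\<in>{i. i < M \<and> v i = y}. cell i) \<union> {t \<in> \<tau> ` {..M}. 0 < t \<and> t < 1 \<and> f t = y}"
    (is "?L = ?R")
  proof
    show "?L \<subseteq> ?R"
    proof
      fix t assume t: "t \<in> ?L"
      show "t \<in> ?R"
      proof (cases "t \<in> \<tau> ` {..M}")
        case False
        then obtain i where "i < M" "t \<in> cell i" using cell_exists t by blast
        then show ?thesis using f t by auto
      qed (use t in auto)
    qed
    show "?R \<subseteq> ?L" using f cell_subset by fastforce
  qed
  moreover have "(\<Union>i\<in>{i. i < M \<and> v i = y}. cell i) \<in> sets borel"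
    by (intro sets.finite_UN) (auto simp: cell_def)
  moreover have "{t \<in> \<tau> ` {..M}. 0 < t \<and> t < 1 \<and> f t = y} \<in> sets borel"
    by (intro borel_closed finite_imp_closed) auto
  ultimately show ?thesis by auto
qed

text \<open>
  The function \<open>f\<close> is arbitrary at the vertex times. It still has finite range on \<open>(0,1)\<close>, so
  the integrand is a combination of finitely many indicator functions of measurable sets.
\<close>
lemma measurable_simplex_word_function:
  fixes f :: "real \<Rightarrow> 'a" and H :: "'a list \<Rightarrow> real"
  assumes f: "\<And>i t. i < M \<Longrightarrow> t \<in> cell i \<Longrightarrow> f t = v i"
  shows "(\<lambda>u. indicator (open_simplex n) u * H (map (\<lambda>j. f (u j)) [1..<n+1]))
    \<in> borel_measurable (Pi\<^sub>M {1..n} (\<lambda>_. lborel))"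
proof -
  define F where "F = v ` {..<M} \<union> f ` \<tau> ` {..M}"
  have "finite F" by (simp add: F_def)
  have F: "f t \<in> F" if "t \<in> {0<..<1}" for t
    using cell_exists[OF that] f by (cases "t \<in> \<tau> ` {..M}") (auto simp: F_def)
  define Y where "Y = {ys. set ys \<subseteq> F \<and> length ys = n}"
  have "finite Y" unfolding Y_def by (rule finite_lists_length_eq[OF \<open>finite F\<close>])
  define S where "S ys = {u \<in> space (Pi\<^sub>M {1..n} (\<lambda>_. lborel)). \<forall>j\<in>{1..n}. u j \<in> {t \<in> {0<..<1}. f t = ys ! (j - 1)}}" for ys
  have S: "S ys \<in> sets (Pi\<^sub>M {1..n} (\<lambda>_. lborel))" for ys
  proof -
    have [measurable]: "{t \<in> {0<..<1}. f t = ys ! (j - 1)} \<in> sets borel" for j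
      by (rule f_finite_range_measurable[of f v]) (rule f)
    show ?thesis unfolding S_def by measurable
  qed
  have "indicator (open_simplex n) u * H (map (\<lambda>j. f (u j)) [1..<n+1])
      = (\<Sum>ys\<in>Y. H ys * indicator (S ys \<inter> open_simplex n) u)"
    if u: "u \<in> space (Pi\<^sub>M {1..n} (\<lambda>_. lborel))" for u
  proof (cases "u \<in> open_simplex n")
    case True
    define zs where "zs = map (\<lambda>j. f (u j)) [1..<n+1]"
    have u01: "u j \<in> {0<..<1}" if "j \<in> {1..n}" for j
      using True that by (simp add: open_simplex_def)
    have zsY: "zs \<in> Y" using F[OF u01] by (auto simp: zs_def Y_def)
    have "u \<in> S ys \<longleftrightarrow> ys = zs" if "ys \<in> Y" for ys
    proof -
      have "u \<in> S ys \<longleftrightarrow> (\<forall>j\<in>{1..n}. f (u j) = ys ! (j - 1))"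
        using u u01 by (auto simp: S_def)
      also have "\<dots> \<longleftrightarrow> (\<forall>k<n. f (u (Suc k)) = ys ! k)"
      proof (intro iffI allI impI ballI)
        fix j assume "\<forall>k<n. f (u (Suc k)) = ys ! k" "j \<in> {1..n}"
        then show "f (u j) = ys ! (j - 1)" by (cases j) auto
      qed force
      also have "\<dots> \<longleftrightarrow> ys = zs"
        using that by (auto simp: zs_def Y_def list_eq_iff_nth_eq simp del: upt_Suc)
      finally show ?thesis .
    qed
    then have "(\<Sum>ys\<in>Y. H ys * indicator (S ys \<inter> open_simplex n) u) = (\<Sum>ys\<in>Y. if ys = zs then H ys else 0)"
      using True by (intro sum.cong) (auto simp: indicator_def)
    then show ?thesis using True zsY \<open>finite Y\<close> by (simp add: zs_def del: upt_Suc)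
  qed simp
  moreover have "(\<lambda>u. \<Sum>ys\<in>Y. H ys * indicator (S ys \<inter> open_simplex n) u) \<in> borel_measurable (Pi\<^sub>M {1..n} (\<lambda>_. lborel))"
    by (intro borel_measurable_sum borel_measurable_times borel_measurable_indicator
        borel_measurable_const sets.Int S sets_open_simplex)
  ultimately show ?thesis
    by (subst measurable_cong) auto
qed

text \<open>
  Almost every point of the simplex avoids the vertex times and lies in the cell of exactly one word.
  Words that are not sorted have empty cells, and sorted words correspond to multisets.
\<close>
lemma simplex_integral_words:
  fixes f :: "real \<Rightarrow> 'a" and H :: "'a list \<Rightarrow> real"
  assumes f: "\<And>i t. i < M \<Longrightarrow> t \<in> cell i \<Longrightarrow> f t = v i"
  shows "fact n * (LINT u:open_simplex n|Pi\<^sub>M {1..n} (\<lambda>_. lborel). H (map (\<lambda>j. f (u j)) [1..<n+1]))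
    = (\<Sum>m\<in>multisets_of_size {..<M} n.
        multinomial_weight gap m * H (map v (sorted_list_of_multiset m)))"
proof -
  let ?P = "Pi\<^sub>M {1..n} (\<lambda>_. lborel :: real measure)"
  define W where "W = {w. set w \<subseteq> {..<M} \<and> length w = n}"
  have "finite W" unfolding W_def by (rule finite_lists_length_eq) simp
  have sets: "word_cell w 1 \<in> sets ?P" if "w \<in> W" for w
    using sets_word_cell[of w 1] that by (simp add: W_def)
  have em: "emeasure ?P (word_cell w 1) = ennreal (word_volume w 1)" if "w \<in> W" for w
    using emeasure_word_cell[of w 1] that by (simp add: W_def)
  have vol_nonneg: "word_volume w 1 \<ge> 0" for w
    unfolding word_volume_def clamped_gap_def by (auto intro!: prod_nonneg)
  have ae: "AE u in ?P. indicator (open_simplex n) u * H (map (\<lambda>j. f (u j)) [1..<n+1])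
      = (\<Sum>w\<in>W. H (map v w) * indicator (word_cell w 1) u)"
    using AE_PiM_lborel_notin_finite[of "{1..n}" "\<tau> ` {..M}", OF finite_atLeastAtMost finite_imageI[OF finite_atMost]] AE_space[of ?P]
  proof eventually_elim
    fix u assume "\<forall>j\<in>{1..n}. u j \<notin> \<tau> ` {..M}" and u: "u \<in> space ?P"
    then have nv: "u j \<notin> \<tau> ` {..M}" if "j \<in> {1..n}" for j using that by blast
    show "indicator (open_simplex n) u * H (map (\<lambda>j. f (u j)) [1..<n+1])
      = (\<Sum>w\<in>W. H (map v w) * indicator (word_cell w 1) u)"
    proof (cases "u \<in> open_simplex n")
      case True
      have u01: "u j \<in> {0<..<1}" if "j \<in> {1..n}" for j
        using True that by (simp add: open_simplex_def)
      define c where "c j = (SOME i. i < M \<and> u j \<in> cell i)" for j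
      have c: "c j < M" "u j \<in> cell (c j)" if "j \<in> {1..n}" for j
        using someI_ex[OF cell_exists[OF u01 nv, OF that that]] unfolding c_def by auto
      define w0 where "w0 = map c [1..<n+1]"
      have w0: "w0 \<in> W" using c by (auto simp: w0_def W_def)
      have "f (u j) = v (c j)" if "j \<in> {1..n}" for j
        using f c[OF that] by blast
      then have "map v w0 = map (\<lambda>j. f (u j)) [1..<n+1]"
        by (auto simp: w0_def simp del: upt_Suc)
      moreover have "u \<in> word_cell w 1 \<longleftrightarrow> w = w0" if w: "w \<in> W" for w
      proof
        assume "u \<in> word_cell w 1"
        then have "u (Suc k) \<in> cell (w ! k)" if "k < n" for k
          using that w by (force simp: word_cell_def W_def dest!: bspec[of _ _ "Suc k"])
        moreover have "w ! k < M" if "k < n" for k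
          using w that by (auto simp: W_def dest: nth_mem)
        ultimately have "w ! k = c (Suc k)" if "k < n" for k
          using that c[of "Suc k"] by (intro cell_inj[of "u (Suc k)"]) auto
        then show "w = w0" using w by (auto simp: w0_def W_def list_eq_iff_nth_eq simp del: upt_Suc)
      next
        assume "w = w0"
        then show "u \<in> word_cell w 1"
          using u u01 c True by (auto simp: word_cell_def w0_def open_simplex_def simp del: upt_Suc)
      qed
      then have "(\<Sum>w\<in>W. H (map v w) * indicator (word_cell w 1) u) = (\<Sum>w\<in>W. if w = w0 then H (map v w) else 0)"
        by (intro sum.cong) (auto simp: indicator_def)
      ultimately show ?thesis using True w0 \<open>finite W\<close> by (simp del: upt_Suc)
    next
      case False
      have "u \<notin> word_cell w 1" if w: "w \<in> W" for w
      proof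
        assume uw: "u \<in> word_cell w 1"
        have "u j > 0" if "j \<in> {1..n}" for j
        proof -
          have "w ! (j - 1) \<in> set w" using that w by (intro nth_mem) (auto simp: W_def)
          then have "w ! (j - 1) < M" using w by (auto simp: W_def)
          moreover have "u j \<in> cell (w ! (j - 1))" using uw that w by (auto simp: word_cell_def W_def)
          ultimately show ?thesis using cell_subset by fastforce
        qed
        then show False using uw False w by (auto simp: word_cell_def open_simplex_def space_PiM_lborel W_def)
      qed
      then show ?thesis using False by simp
    qed
  qed
  have "(LINT u:open_simplex n|?P. H (map (\<lambda>j. f (u j)) [1..<n+1]))
      = (\<integral>u. indicator (open_simplex n) u * H (map (\<lambda>j. f (u j)) [1..<n+1]) \<partial>?P)"
    by (simp add: set_lebesgue_integral_def del: upt_Suc)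
  also have "\<dots> = (\<integral>u. (\<Sum>w\<in>W. H (map v w) * indicator (word_cell w 1) u) \<partial>?P)"
    using sets by (intro integral_cong_AE ae measurable_simplex_word_function[of f v] f
      borel_measurable_sum borel_measurable_times borel_measurable_indicator) auto
  also have "\<dots> = (\<Sum>w\<in>W. \<integral>u. H (map v w) * indicator (word_cell w 1) u \<partial>?P)"
    using sets em by (intro Bochner_Integration.integral_sum integrable_mult_right integrable_real_indicator)
      (auto simp: less_top)
  also have "\<dots> = (\<Sum>w\<in>W. H (map v w) * word_volume w 1)"
    using sets em vol_nonneg by (intro sum.cong refl) (simp add: measure_def sets.sets_into_space Int_absorb1 )
  also have "fact n * \<dots> = (\<Sum>w\<in>W. fact n * word_volume w 1 * H (map v w))"
    by (simp add: sum_distrib_left mult_ac)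
  also have "\<dots> = (\<Sum>w | w \<in> W \<and> sorted w. multinomial_weight gap (mset w) * H (map v w))"
    using \<open>finite W\<close> word_volume_one
    by (intro sum.mono_neutral_cong_right) (auto simp: W_def word_volume_def)
  also have "\<dots> = (\<Sum>m\<in>multisets_of_size {..<M} n.
        multinomial_weight gap m * H (map v (sorted_list_of_multiset m)))"
    by (rule sum.reindex_bij_witness[of _ sorted_list_of_multiset mset])
      (auto simp: W_def multisets_of_size_def sorted_sort_id simp flip: size_mset)
  finally show ?thesis .
qed

end

section \<open>Positions in sorted words\<close>

definition insert_at :: "nat \<Rightarrow> 'a \<Rightarrow> 'a list \<Rightarrow> 'a list" where
  "insert_at k x ys = take k ys @ [x] @ drop k ys"

lemma length_insert_at [simp]: "length (insert_at k x ys) = Suc (length ys)"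
  by (simp add: insert_at_def)

lemma set_insert_at_subset: "set (insert_at k x ys) \<subseteq> insert x (set ys)"
  by (auto simp: insert_at_def dest: in_set_takeD in_set_dropD)

lemma insert_at_map: "insert_at k (h x) (map h ys) = map h (insert_at k x ys)"
  by (simp add: insert_at_def take_map drop_map)

text \<open>
  Inserting at a fixed position agrees with inserting in order when the letter already stands there.
\<close>
lemma insert_at_remove_sorted:
  assumes "k < size m" "sorted_list_of_multiset m ! k = i"
  shows "insert_at k i (sorted_list_of_multiset (m - {#i#})) = sorted_list_of_multiset m"
proof -
  define w where "w = sorted_list_of_multiset m"
  have w: "sorted w" "mset w = m" "k < length w" "w ! k = i"
    using assms by (simp_all add: w_def flip: size_mset)
  have split: "w = take k w @ i # drop (Suc k) w"
    using id_take_nth_drop[OF w(3)] w(4) by simp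
  then have sorted: "sorted (take k w @ drop (Suc k) w)"
    using w(1) by (metis sorted_append sorted_simps(2) list.set_intros(2))
  have "mset w = mset (take k w @ i # drop (Suc k) w)" using split by simp
  then have "m - {#i#} = mset (take k w @ drop (Suc k) w)" using w(2) by simp
  then have "sorted_list_of_multiset (m - {#i#}) = take k w @ drop (Suc k) w"
    using sorted by (simp only: sorted_list_of_multiset_mset sorted_sort_id)
  then show ?thesis
    using split w(3) unfolding w_def[symmetric] by (simp add: insert_at_def)
qed

lemma sum_count_eq_length_filter:
  assumes "finite B"
  shows "(\<Sum>j\<in>B. count (mset w) j) = length (filter (\<lambda>j. j \<in> B) w)"
proof -
  have "length (filter (\<lambda>j. j \<in> B) w) = (\<Sum>j\<in>B. count (mset (filter (\<lambda>j. j \<in> B) w)) j)"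
    unfolding size_mset[symmetric] by (rule size_eq_sum_count[OF assms]) auto
  also have "\<dots> = (\<Sum>j\<in>B. count (mset w) j)" by (intro sum.cong) auto
  finally show ?thesis ..
qed

lemma sorted_nth_less_imp_count:
  assumes "sorted w" "k < length w" "w ! k < (i::nat)"
  shows "k < (\<Sum>j<i. count (mset w) j)"
proof -
  have "\<forall>x\<in>set (take (Suc k) w). x < i"
  proof
    fix x assume "x \<in> set (take (Suc k) w)"
    then obtain j where "j < length (take (Suc k) w)" "x = take (Suc k) w ! j"
      by (metis in_set_conv_nth)
    then have "j \<le> k" "x = w ! j" by auto
    then show "x < i" using sorted_nth_mono[OF assms(1), of j k] assms by simp
  qed
  then have "filter (\<lambda>j. j \<in> {..<i}) (take (Suc k) w) = take (Suc k) w" by simp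
  then have "length (filter (\<lambda>j. j \<in> {..<i}) w) = Suc k + length (filter (\<lambda>j. j \<in> {..<i}) (drop (Suc k) w))"
    using assms(2) by (subst append_take_drop_id[of "Suc k" w, symmetric], subst filter_append) simp
  then show ?thesis using sum_count_eq_length_filter[of "{..<i}" w] by simp
qed

lemma sorted_nth_greater_imp_count:
  assumes "sorted w" "k < length w" "w ! k > (i::nat)"
  shows "(\<Sum>j<Suc i. count (mset w) j) \<le> k"
proof -
  have "\<forall>x\<in>set (drop k w). \<not> x < Suc i"
  proof
    fix x assume "x \<in> set (drop k w)"
    then obtain j where "j < length w - k" "x = drop k w ! j"
      by (metis in_set_conv_nth length_drop)
    then have "k + j < length w" "x = w ! (k + j)" by auto
    then show "\<not> x < Suc i" using sorted_nth_mono[OF assms(1), of k "k + j"] assms by simp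
  qed
  then have "filter (\<lambda>j. j \<in> {..<Suc i}) (drop k w) = []" by (simp add: filter_empty_conv)
  then have "length (filter (\<lambda>j. j \<in> {..<Suc i}) w) = length (filter (\<lambda>j. j \<in> {..<Suc i}) (take k w))"
    by (subst append_take_drop_id[of k w, symmetric], subst filter_append) simp
  also have "\<dots> \<le> k" using length_filter_le[of _ "take k w"] by (metis length_take min.bounded_iff)
  finally show ?thesis using sum_count_eq_length_filter[of "{..<Suc i}" w] by simp
qed

lemma apply_ops_append:
  assumes "length vs = length Bs"
  shows "apply_ops (Bs @ Cs) z (vs @ us) = apply_ops Bs (apply_ops Cs z us) vs"
  using assms
proof (induction Bs arbitrary: vs)
  case (Cons B Bs)
  then show ?case by (cases vs) auto
qed simp

lemma apply_ops_replicate: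
  assumes "length w = n"
  shows "apply_ops (replicate n B) z (map v w) = foldr (\<lambda>i. B (v i)) w z"
  using assms by (induction w arbitrary: n) auto

lemma foldr_scaleR:
  assumes "\<And>i. linear (P i)"
  shows "foldr P w (c *\<^sub>R z) = c *\<^sub>R foldr P w z"
  by (induction w) (simp_all add: linear_cmul[OF assms])

lemma apply_ops_insert_at:
  assumes k: "k \<le> length w" and lin: "\<And>v. linear (B v)"
  shows "apply_ops (replicate k B @ [\<lambda>v x. inner v y *\<^sub>R x] @ replicate (length w - k) B) z
      (insert_at k x (map v w)) = inner x y *\<^sub>R foldr (\<lambda>i. B (v i)) w z"
proof -
  have "apply_ops (replicate k B @ [\<lambda>v x. inner v y *\<^sub>R x] @ replicate (length w - k) B) z
      (map v (take k w) @ ([x] @ map v (drop k w)))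
      = foldr (\<lambda>i. B (v i)) (take k w) (inner x y *\<^sub>R foldr (\<lambda>i. B (v i)) (drop k w) z)"
    using k by (subst apply_ops_append) (simp_all add: apply_ops_replicate)
  also have "\<dots> = inner x y *\<^sub>R foldr (\<lambda>i. B (v i)) (take k w @ drop k w) z"
    unfolding foldr_append by (subst foldr_scaleR) (simp_all add: lin)
  also have "take k w @ drop k w = w" by simp
  finally show ?thesis by (simp only: insert_at_def take_map drop_map)
qed

context time_partition
begin

section \<open>Inserting the tangent vector\<close>

abbreviation \<mu> :: "nat multiset \<Rightarrow> real" where "\<mu> \<equiv> multinomial_weight gap"

abbreviation words :: "nat \<Rightarrow> nat multiset set" where "words n \<equiv> multisets_of_size {..<M} n"

lemma finite_words: "finite (words n)"
  by auto

lemma \<mu>_nonneg: "m \<in> words n \<Longrightarrow> \<mu> m \<ge> 0"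
  by (intro multinomial_weight_nonneg) (auto simp: multisets_of_size_def intro: less_imp_le gap_pos)

lemma length_word: "m \<in> words n \<Longrightarrow> length (sorted_list_of_multiset m) = n"
  by (simp add: multisets_of_size_def flip: size_mset)

lemma norm_signature_eq_sum:
  assumes "\<And>i t. i < M \<Longrightarrow> t \<in> cell i \<Longrightarrow> f t = v i"
  shows "norm_signature f n is
    = (\<Sum>m\<in>words n. \<mu> m * pure_tensor (map v (sorted_list_of_multiset m)) is)"
  unfolding norm_signature_def simplex_integral_def
  using simplex_integral_words[of f v, OF assms, of n "\<lambda>ys. pure_tensor ys is"] by simp

lemma insertion_eq_sum:
  assumes "\<And>i t. i < M \<Longrightarrow> t \<in> cell i \<Longrightarrow> f t = v i" and p: "p \<in> {1..n+1}"
  shows "insertion f p n x is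
    = (\<Sum>m\<in>words n. \<mu> m * pure_tensor (insert_at (p - 1) x (map v (sorted_list_of_multiset m))) is)"
proof -
  have "map (\<lambda>j. f (u j)) [1..<p] @ [x] @ map (\<lambda>j. f (u j)) [p..<n+1]
      = insert_at (p - 1) x (map (\<lambda>j. f (u j)) [1..<n+1])" for u :: "nat \<Rightarrow> real"
    using p by (simp add: insert_at_def take_map drop_map del: upt_Suc)
  then show ?thesis
    unfolding insertion_def simplex_integral_def
    using simplex_integral_words[of f v, OF assms(1), of n "\<lambda>ys. pure_tensor (insert_at (p - 1) x ys) is"]
    by simp
qed

text \<open>
  Size biasing writes the insertion map at \<open>v i\<close> as an expectation over words of length \<open>n+1\<close>, the same
  probability space as for the signature of order \<open>n+1\<close>. Words without the letter \<open>i\<close> have coefficient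
  \<open>0\<close>, so it is harmless that removing \<open>i\<close> does not shorten them.
\<close>
lemma insertion_tangent_eq_sum:
  fixes v :: "nat \<Rightarrow> real^'d"
  assumes "\<And>i t. i < M \<Longrightarrow> t \<in> cell i \<Longrightarrow> f t = v i" and p: "p \<in> {1..n+1}" and i: "i < M"
  shows "insertion f p n (v i) is = (\<Sum>m\<in>words (Suc n).
    \<mu> m * (real (count m i) / (real (Suc n) * gap i)) *
    pure_tensor (map v (insert_at (p - 1) i (sorted_list_of_multiset (m - {#i#})))) is)"
proof -
  let ?g = "\<lambda>m. pure_tensor (map v (insert_at (p - 1) i (sorted_list_of_multiset (m - {#i#})))) is"
  have "(\<Sum>m\<in>words (Suc n). \<mu> m * (real (count m i) * ?g m))
      = real (Suc n) * gap i * insertion f p n (v i) is"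
    using i by (subst size_bias) (simp_all add: insertion_eq_sum[of f v, OF assms(1,2)] insert_at_map)
  moreover have "real (Suc n) * gap i \<noteq> 0" using gap_pos[OF i] by simp
  ultimately have "insertion f p n (v i) is
      = (\<Sum>m\<in>words (Suc n). \<mu> m * (real (count m i) * ?g m)) / (real (Suc n) * gap i)"
    by simp
  then show ?thesis by (simp add: sum_divide_distrib mult.assoc)
qed

text \<open>
  Word by word the two pure tensors coincide if the letter at position \<open>p\<close> is \<open>i\<close>, and then only the
  coefficients differ. Otherwise both tensors are estimated separately, using
  \<open>X + 1 \<le> \<bar>X - 1\<bar> + 2\<close>. All factors are unit vectors.
\<close>
lemma proj_norm_insertion_tangent_le_expectation:
  fixes v :: "nat \<Rightarrow> real^'d"
  assumes f: "\<And>i t. i < M \<Longrightarrow> t \<in> cell i \<Longrightarrow> f t = v i" and v: "\<And>i. i < M \<Longrightarrow> norm (v i) = 1"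
    and p: "p \<in> {1..n+1}" and i: "i < M"
  shows "proj_norm (n+1) (\<lambda>is. insertion f p n (v i) is - norm_signature f (n+1) is)
    \<le> (\<Sum>m\<in>words (Suc n). \<mu> m * (\<bar>real (count m i) / (real (Suc n) * gap i) - 1\<bar>
        + 2 * of_bool (sorted_list_of_multiset m ! (p - 1) \<noteq> i)))"
proof -
  let ?w = sorted_list_of_multiset
  define X where "X m = real (count m i) / (real (Suc n) * gap i)" for m
  define good where "good m \<longleftrightarrow> ?w m ! (p - 1) = i" for m
  \<comment> \<open>Each word \<open>m\<close> yields one term for the signature (\<open>b = True\<close>) and one for the insertion map; for a
    good word they are merged. The vectors chosen when \<open>i \<notin># m\<close> only provide the right length.\<close>
  define c where "c = (\<lambda>(m, b). if b then (if good m then \<mu> m * (X m - 1) else - \<mu> m)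
    else if good m then 0 else \<mu> m * X m)"
  define vs where "vs = (\<lambda>(m, b). if b \<or> i \<notin># m then map v (?w m)
    else map v (insert_at (p - 1) i (?w (m - {#i#}))))"
  have rep: "insertion f p n (v i) is - norm_signature f (n+1) is
      = (\<Sum>a\<in>words (Suc n) \<times> UNIV. c a * pure_tensor (vs a) is)" for "is"
  proof -
    have "insertion f p n (v i) is - norm_signature f (n+1) is
        = (\<Sum>m\<in>words (Suc n). \<mu> m * X m * pure_tensor (map v (insert_at (p - 1) i (?w (m - {#i#})))) is
            - \<mu> m * pure_tensor (map v (?w m)) is)"
      using norm_signature_eq_sum[of f v "Suc n" "is", OF f] insertion_tangent_eq_sum[of f v p n i "is", OF f p i]
      by (simp add: sum_subtractf X_def)
    also have "\<dots> = (\<Sum>m\<in>words (Suc n). \<Sum>b\<in>UNIV. c (m, b) * pure_tensor (vs (m, b)) is)"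
    proof (intro sum.cong refl)
      fix m assume m: "m \<in> words (Suc n)"
      have "map v (insert_at (p - 1) i (?w (m - {#i#}))) = map v (?w m)" if "good m"
        using insert_at_remove_sorted[of "p - 1" m i] that p m
        by (auto simp: good_def multisets_of_size_def)
      moreover have "X m = 0" if "i \<notin># m" using that by (simp add: X_def not_in_iff)
      ultimately show "\<mu> m * X m * pure_tensor (map v (insert_at (p - 1) i (?w (m - {#i#})))) is
            - \<mu> m * pure_tensor (map v (?w m)) is = (\<Sum>b\<in>UNIV. c (m, b) * pure_tensor (vs (m, b)) is)"
        by (auto simp: UNIV_bool c_def vs_def algebra_simps)
    qed
    finally show ?thesis by (simp add: sum.cartesian_product)
  qed
  have len: "length (vs a) = n + 1" if *: "a \<in> words (Suc n) \<times> UNIV" for a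
  proof -
    obtain m b where a: "a = (m, b)" "m \<in> words (Suc n)" using * by (cases a) auto
    have "length (?w (m - {#i#})) = n" if "i \<in># m"
      using that a(2) by (intro length_word) (auto simp: multisets_of_size_def size_Diff_singleton dest: in_diffD)
    then show ?thesis using a length_word[OF a(2)] by (simp add: vs_def)
  qed
  have unit: "(\<Prod>u\<leftarrow>map v w. norm u) = 1" if "set w \<subseteq> {..<M}" for w
    using that v by (induction w) auto
  have prod: "(\<Prod>u\<leftarrow>vs a. norm u) = 1" if *: "a \<in> words (Suc n) \<times> UNIV" for a
  proof -
    obtain m b where a: "a = (m, b)" "m \<in> words (Suc n)" using * by (cases a) auto
    have m: "set_mset m \<subseteq> {..<M}" using a(2) by (simp add: multisets_of_size_def)
    then have "set (insert_at (p - 1) i (?w (m - {#i#}))) \<subseteq> {..<M}"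
      using i by (intro order.trans[OF set_insert_at_subset]) (auto dest: in_diffD)
    then show ?thesis using a unit m by (simp add: vs_def)
  qed
  have "proj_norm (n+1) (\<lambda>is. insertion f p n (v i) is - norm_signature f (n+1) is)
      \<le> (\<Sum>a\<in>words (Suc n) \<times> UNIV. \<bar>c a\<bar> * (\<Prod>u\<leftarrow>vs a. norm u))"
    using finite_words by (intro proj_norm_le_sum rep len) auto
  also have "\<dots> = (\<Sum>a\<in>words (Suc n) \<times> UNIV. \<bar>c a\<bar>)"
    using prod by (intro sum.cong) auto
  also have "\<dots> = (\<Sum>m\<in>words (Suc n). \<Sum>b\<in>UNIV. \<bar>c (m, b)\<bar>)"
    by (simp add: sum.cartesian_product)
  also have "\<dots> \<le> (\<Sum>m\<in>words (Suc n). \<mu> m * (\<bar>X m - 1\<bar> + 2 * of_bool (\<not> good m)))"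
  proof (intro sum_mono)
    fix m assume m: "m \<in> words (Suc n)"
    have "X m \<ge> 0" using gap_pos[OF i] by (simp add: X_def)
    then have "\<mu> m * (1 + X m) \<le> \<mu> m * (\<bar>X m - 1\<bar> + 2)"
      using \<mu>_nonneg[OF m] by (intro mult_left_mono) auto
    then show "(\<Sum>b\<in>UNIV. \<bar>c (m, b)\<bar>) \<le> \<mu> m * (\<bar>X m - 1\<bar> + 2 * of_bool (\<not> good m))"
      using \<mu>_nonneg[OF m] \<open>X m \<ge> 0\<close>
      by (cases "good m") (simp_all add: UNIV_bool c_def abs_mult distrib_left)
  qed
  finally show ?thesis by (simp add: X_def good_def)
qed

text \<open>
  The second moment of \<open>count m i / ((n+1) gap i) - 1\<close> is \<open>O(1/n)\<close>.
\<close>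
lemma count_ratio_expectation_le:
  assumes i: "i < M"
  shows "(\<Sum>m\<in>words (Suc n). \<mu> m * \<bar>real (count m i) / (real (Suc n) * gap i) - 1\<bar>)
    \<le> (1 / gap i + 1) / sqrt (real (Suc n))"
proof -
  define N where "N = real (Suc n)"
  define g where "g = gap i"
  have N: "N > 0" and g: "g > 0" using gap_pos[OF i] by (simp_all add: N_def g_def)
  define X where "X m = real (count m i) / (N * g) - 1" for m
  have var: "(\<Sum>m\<in>words (Suc n). \<mu> m * (X m)\<^sup>2) = (1 - g) / (N * g)"
  proof -
    have X: "(X m)\<^sup>2 = (real (count m i) - N * g)\<^sup>2 / (N * g)\<^sup>2" for m
    proof -
      have "X m = (real (count m i) - N * g) / (N * g)"
        using N g by (simp add: X_def diff_divide_distrib)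
      then show ?thesis by (simp only: power_divide)
    qed
    have "(\<Sum>m\<in>words (Suc n). \<mu> m * (X m)\<^sup>2)
        = (\<Sum>m\<in>words (Suc n). \<mu> m * (real (count m i) - N * g)\<^sup>2) / (N * g)\<^sup>2"
      by (simp add: X sum_divide_distrib)
    also have "\<dots> = N * g * (1 - g) / (N * g)\<^sup>2"
      using multinomial_variance[of "{..<M}" gap "{i}" "Suc n"] i sum_gap by (simp add: N_def g_def)
    also have "\<dots> = (1 - g) / (N * g)" using N g by (simp add: power2_eq_square)
    finally show ?thesis .
  qed
  \<comment> \<open>This pointwise bound replaces the Cauchy-Schwarz inequality for expectations.\<close>
  have "\<bar>y\<bar> \<le> y\<^sup>2 * sqrt N + 1 / sqrt N" for y :: real
  proof -
    have "0 \<le> (\<bar>y\<bar> * sqrt N - 1)\<^sup>2" by simp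
    then have "2 * (\<bar>y\<bar> * sqrt N) \<le> y\<^sup>2 * N + 1"
      using N by (simp add: power2_diff power_mult_distrib mult.assoc)
    moreover have "0 \<le> \<bar>y\<bar> * sqrt N" using N by simp
    ultimately have "\<bar>y\<bar> * sqrt N \<le> y\<^sup>2 * N + 1" by linarith
    then have "\<bar>y\<bar> * sqrt N / sqrt N \<le> (y\<^sup>2 * N + 1) / sqrt N" using N by (intro divide_right_mono) auto
    moreover have "N / sqrt N = sqrt N" using N by (simp add: real_div_sqrt)
    ultimately show ?thesis using N by (simp add: add_divide_distrib flip: times_divide_eq_right)
  qed
  then have "(\<Sum>m\<in>words (Suc n). \<mu> m * \<bar>X m\<bar>) \<le> (\<Sum>m\<in>words (Suc n). \<mu> m * ((X m)\<^sup>2 * sqrt N + 1 / sqrt N))"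
    using \<mu>_nonneg by (intro sum_mono mult_left_mono) auto
  also have "\<dots> = (\<Sum>m\<in>words (Suc n). \<mu> m * (X m)\<^sup>2) * sqrt N + (\<Sum>m\<in>words (Suc n). \<mu> m) * (1 / sqrt N)"
    by (simp add: distrib_left sum.distrib sum_distrib_right sum_divide_distrib mult.assoc)
  also have "\<dots> = (1 - g) / g / sqrt N + 1 / sqrt N"
    unfolding var using sum_multinomial_weight[of "{..<M}" gap "Suc n"] sum_gap N g
    by (simp add: field_simps)
  also have "\<dots> \<le> (1 / g + 1) / sqrt N"
    using N g by (simp add: add_divide_distrib diff_divide_distrib)
  finally show ?thesis by (simp add: X_def N_def g_def)
qed

text \<open>
  A letter below \<open>i\<close> at position \<open>p\<close> means that at least \<open>p\<close> letters are below \<open>i\<close>; a letter above \<open>i\<close> means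
  that at most \<open>p - 1\<close> letters are at most \<open>i\<close>. The expected numbers are \<open>(n+1) \<tau> i\<close> and \<open>(n+1) \<tau> (i+1)\<close>, so
  either event is a deviation by \<open>D\<close>, and Chebyshev's inequality applies.
\<close>
lemma misplaced_letter_probability_le:
  assumes i: "i < M" and p: "p \<in> {1..n+1}" and D: "D > 0"
    and lo: "real (Suc n) * \<tau> i + D \<le> real p" and hi: "real p + D \<le> real (Suc n) * \<tau> (Suc i) + 1"
  shows "(\<Sum>m\<in>words (Suc n). \<mu> m * of_bool (sorted_list_of_multiset m ! (p - 1) \<noteq> i))
    \<le> 2 * real (Suc n) / D\<^sup>2"
proof -
  define N where "N = real (Suc n)"
  define K where "K j m = (\<Sum>l<j. real (count m l))" for j and m :: "nat multiset"
  have var: "(\<Sum>m\<in>words (Suc n). \<mu> m * (K j m - N * \<tau> j)\<^sup>2) \<le> N" if "j \<le> M" for j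
  proof -
    have "(\<Sum>m\<in>words (Suc n). \<mu> m * (K j m - N * \<tau> j)\<^sup>2) = N * \<tau> j * (1 - \<tau> j)"
      using multinomial_variance[of "{..<M}" gap "{..<j}" "Suc n"] that sum_gap sum_gap_lessThan[of j]
      by (simp add: K_def N_def)
    also have "\<dots> = N * (\<tau> j * (1 - \<tau> j))" by simp
    also have "\<dots> \<le> N * 1"
      using \<tau>_mono[of 0 j] \<tau>_mono[of j M] that \<tau>_0 \<tau>_M
      by (intro mult_left_mono mult_le_one) (auto simp: N_def)
    finally show ?thesis by simp
  qed
  have "(\<Sum>m\<in>words (Suc n). \<mu> m * of_bool (sorted_list_of_multiset m ! (p - 1) \<noteq> i))
      \<le> (\<Sum>m\<in>words (Suc n). \<mu> m * (((K i m - N * \<tau> i)\<^sup>2 + (K (Suc i) m - N * \<tau> (Suc i))\<^sup>2) / D\<^sup>2))"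
  proof (intro sum_mono mult_left_mono)
    fix m assume m: "m \<in> words (Suc n)"
    let ?w = "sorted_list_of_multiset m"
    have w: "sorted ?w" "p - 1 < length ?w" using length_word[OF m] p by auto
    have "D\<^sup>2 \<le> (K i m - N * \<tau> i)\<^sup>2 + (K (Suc i) m - N * \<tau> (Suc i))\<^sup>2" if "?w ! (p - 1) \<noteq> i"
    proof (cases "?w ! (p - 1) < i")
      case True
      have "real p \<le> K i m"
        using sorted_nth_less_imp_count[OF w True] p by (simp add: K_def flip: of_nat_sum)
      then have "D\<^sup>2 \<le> (K i m - N * \<tau> i)\<^sup>2"
        using lo D by (intro power_mono) (auto simp: N_def)
      then show ?thesis using zero_le_power2[of "K (Suc i) m - N * \<tau> (Suc i)"] by linarith
    next
      case False
      then have "i < ?w ! (p - 1)" using that by simp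
      then have "real (\<Sum>j<Suc i. count m j) \<le> real (p - 1)"
        using sorted_nth_greater_imp_count[OF w, of i] unfolding of_nat_le_iff by simp
      then have "K (Suc i) m \<le> real p - 1"
        using p by (simp add: K_def of_nat_diff)
      then have "D\<^sup>2 \<le> (N * \<tau> (Suc i) - K (Suc i) m)\<^sup>2"
        using hi D by (intro power_mono) (auto simp: N_def)
      also have "\<dots> = (K (Suc i) m - N * \<tau> (Suc i))\<^sup>2" by (rule power2_commute)
      finally show ?thesis using zero_le_power2[of "K i m - N * \<tau> i"] by linarith
    qed
    then show "of_bool (?w ! (p - 1) \<noteq> i) \<le> ((K i m - N * \<tau> i)\<^sup>2 + (K (Suc i) m - N * \<tau> (Suc i))\<^sup>2) / D\<^sup>2"
      using D by (auto simp: le_divide_eq)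
  qed (rule \<mu>_nonneg)
  also have "\<dots> = ((\<Sum>m\<in>words (Suc n). \<mu> m * (K i m - N * \<tau> i)\<^sup>2)
      + (\<Sum>m\<in>words (Suc n). \<mu> m * (K (Suc i) m - N * \<tau> (Suc i))\<^sup>2)) / D\<^sup>2"
    by (simp add: sum_divide_distrib distrib_left sum.distrib add_divide_distrib)
  also have "\<dots> \<le> (N + N) / D\<^sup>2"
    using var[of i] var[of "Suc i"] i by (intro divide_right_mono add_mono) auto
  finally show ?thesis by (simp add: N_def)
qed

lemma proj_norm_insertion_tangent_le:
  fixes v :: "nat \<Rightarrow> real^'d"
  assumes f: "\<And>i t. i < M \<Longrightarrow> t \<in> cell i \<Longrightarrow> f t = v i" and v: "\<And>i. i < M \<Longrightarrow> norm (v i) = 1"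
    and i: "i < M" and p: "p \<in> {1..n+1}" and D: "D > 0"
    and lo: "real (Suc n) * \<tau> i + D \<le> real p" and hi: "real p + D \<le> real (Suc n) * \<tau> (Suc i) + 1"
  shows "proj_norm (n+1) (\<lambda>is. insertion f p n (v i) is - norm_signature f (n+1) is)
    \<le> (1 / gap i + 1) / sqrt (real (Suc n)) + 4 * real (Suc n) / D\<^sup>2"
proof -
  have "(\<Sum>m\<in>words (Suc n). \<mu> m * (\<bar>real (count m i) / (real (Suc n) * gap i) - 1\<bar>
        + 2 * of_bool (sorted_list_of_multiset m ! (p - 1) \<noteq> i)))
      = (\<Sum>m\<in>words (Suc n). \<mu> m * \<bar>real (count m i) / (real (Suc n) * gap i) - 1\<bar>)
        + 2 * (\<Sum>m\<in>words (Suc n). \<mu> m * of_bool (sorted_list_of_multiset m ! (p - 1) \<noteq> i))"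
    by (simp add: distrib_left sum.distrib sum_distrib_left mult_ac)
  also have "\<dots> \<le> (1 / gap i + 1) / sqrt (real (Suc n)) + 2 * (2 * real (Suc n) / D\<^sup>2)"
    using count_ratio_expectation_le[OF i, of n] misplaced_letter_probability_le[OF i p D lo hi]
    by (intro add_mono mult_left_mono) auto
  finally show ?thesis
    using proj_norm_insertion_tangent_le_expectation[of f v p n i, OF f v p i] by simp
qed

section \<open>Stability of the insertion map\<close>

text \<open>
  Contracting position \<open>p\<close> with the direction of \<open>x - y\<close> and the other positions with boosts sends the
  insertion of \<open>x'\<close> to the contracted signature, scaled by \<open>\<langle>x', sgn (x - y)\<rangle>\<close>. The difference of the
  scalars at \<open>x\<close> and \<open>y\<close> is \<open>norm (x - y)\<close>, and the signature subtracted in both arguments cancels.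
\<close>
lemma dist_le_proj_norm_insertion:
  fixes v :: "nat \<Rightarrow> real^'d"
  assumes f: "\<And>i t. i < M \<Longrightarrow> t \<in> cell i \<Longrightarrow> f t = v i" and p: "p \<in> {1..n+1}"
  shows "norm (x - y) * norm (multinomial_word_sum gap (\<lambda>i. boost (v i)) z {..<M} n)
    \<le> (proj_norm (n+1) (\<lambda>is. insertion f p n x is - norm_signature f (n+1) is)
      + proj_norm (n+1) (\<lambda>is. insertion f p n y is - norm_signature f (n+1) is)) * norm z"
proof -
  define B where "B = (\<lambda>(u::real^'d) (a::(real^'d) \<times> real). inner u (sgn (x - y)) *\<^sub>R a)"
  define Bs where "Bs = replicate (p - 1) boost @ [B] @ replicate (n - (p - 1)) boost"
  have len: "length Bs = n + 1" using p by (auto simp: Bs_def)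
  have B: "norm (B u a) \<le> norm u * norm a" for u a
  proof -
    have "\<bar>inner u (sgn (x - y))\<bar> \<le> norm u * norm (sgn (x - y))" by (rule Cauchy_Schwarz_ineq2)
    also have "\<dots> \<le> norm u * 1" by (intro mult_left_mono) (auto simp: norm_sgn)
    finally show ?thesis by (simp add: B_def mult_right_mono)
  qed
  have "bounded_bilinear B"
  proof
    show "\<exists>K. \<forall>u a. norm (B u a) \<le> norm u * norm a * K" using B by (metis mult.right_neutral)
  qed (simp_all add: B_def algebra_simps inner_add_left)
  then have bil: "bounded_bilinear C" if "C \<in> set Bs" for C
    using that bounded_bilinear_boost by (auto simp: Bs_def split: if_splits)
  have bnd: "norm (C u a) \<le> norm u * norm a" if "C \<in> set Bs" for C u a
  proof -
    have "C = B \<or> C = boost" using that by (auto simp: Bs_def split: if_splits)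
    then show ?thesis using B[of u a] norm_boost_le[of u a] by metis
  qed
  define G where "G = multinomial_word_sum gap (\<lambda>i. boost (v i)) z {..<M} n"
  define T where "T = (\<lambda>x is. insertion f p n x is - norm_signature f (n+1) is)"
  have lin: "linear (boost u)" for u :: "real^'d"
    using linear_boost_funpow[of 1 u] by simp
  have ins: "contract Bs z (insertion f p n x') = inner x' (sgn (x - y)) *\<^sub>R G" for x'
  proof -
    have "contract Bs z (insertion f p n x')
        = (\<Sum>m\<in>words n. contract Bs z (\<lambda>is. \<mu> m * pure_tensor (insert_at (p - 1) x' (map v (sorted_list_of_multiset m))) is))"
    proof -
      have "insertion f p n x' = (\<lambda>is. \<Sum>m\<in>words n. \<mu> m * pure_tensor (insert_at (p - 1) x' (map v (sorted_list_of_multiset m))) is)"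
        by (rule ext, rule insertion_eq_sum[of f v]) (use f p in auto)
      then show ?thesis by (simp only: contract_sum[OF bil])
    qed
    also have "\<dots> = (\<Sum>m\<in>words n. \<mu> m *\<^sub>R (inner x' (sgn (x - y)) *\<^sub>R foldr (\<lambda>i. boost (v i)) (sorted_list_of_multiset m) z))"
    proof (intro sum.cong refl)
      fix m assume m: "m \<in> words n"
      have "contract Bs z (pure_tensor (insert_at (p - 1) x' (map v (sorted_list_of_multiset m))))
          = apply_ops Bs z (insert_at (p - 1) x' (map v (sorted_list_of_multiset m)))"
        using len length_word[OF m] by (intro contract_pure_tensor bil) auto
      also have "\<dots> = inner x' (sgn (x - y)) *\<^sub>R foldr (\<lambda>i. boost (v i)) (sorted_list_of_multiset m) z"
        using apply_ops_insert_at[of "p - 1" "sorted_list_of_multiset m" boost "sgn (x - y)" z x' v, OF _ lin]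
          p length_word[OF m] by (auto simp: Bs_def B_def)
      finally show "contract Bs z (\<lambda>is. \<mu> m * pure_tensor (insert_at (p - 1) x' (map v (sorted_list_of_multiset m))) is)
          = \<mu> m *\<^sub>R (inner x' (sgn (x - y)) *\<^sub>R foldr (\<lambda>i. boost (v i)) (sorted_list_of_multiset m) z)"
        by (simp add: contract_scale[OF bil])
    qed
    also have "\<dots> = inner x' (sgn (x - y)) *\<^sub>R G"
      by (simp add: G_def multinomial_word_sum_def scaleR_sum_right mult.commute)
    finally show ?thesis .
  qed
  have bound: "norm (contract Bs z (T x')) \<le> proj_norm (n+1) (T x') * norm z" for x'
  proof (rule norm_contract_le_proj_norm[of Bs "words n <+> words (Suc n)" "n+1"
      "case_sum (\<lambda>m. insert_at (p - 1) x' (map v (sorted_list_of_multiset m))) (\<lambda>m. map v (sorted_list_of_multiset m))"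
      "T x'" "case_sum \<mu> (\<lambda>m. - \<mu> m)"])
    show "T x' is = (\<Sum>a\<in>words n <+> words (Suc n). case_sum \<mu> (\<lambda>m. - \<mu> m) a *
      pure_tensor (case_sum (\<lambda>m. insert_at (p - 1) x' (map v (sorted_list_of_multiset m))) (\<lambda>m. map v (sorted_list_of_multiset m)) a) is)" for "is"
      using norm_signature_eq_sum[of f v "Suc n" "is", OF f] insertion_eq_sum[of f v p n x' "is", OF f p] finite_words
      by (simp add: T_def sum.Plus sum_negf)
  qed (use bil bnd len finite_words length_word in auto)
  have "norm (x - y) *\<^sub>R G = contract Bs z (T x) - contract Bs z (T y)"
  proof -
    have "norm (x - y) = inner (x - y) (sgn (x - y))"
      by (cases "x = y") (simp_all add: sgn_div_norm dot_square_norm power2_eq_square)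
    then show ?thesis
      by (simp add: T_def contract_diff[OF bil] ins inner_diff_left scaleR_left_diff_distrib)
  qed
  then have "norm (x - y) * norm G = norm (contract Bs z (T x) - contract Bs z (T y))"
    by (metis norm_scaleR abs_norm_cancel)
  also have "\<dots> \<le> norm (contract Bs z (T x)) + norm (contract Bs z (T y))" by (rule norm_triangle_ineq4)
  also have "\<dots> \<le> (proj_norm (n+1) (T x) + proj_norm (n+1) (T y)) * norm z"
    using bound[of x] bound[of y] by (simp add: distrib_right)
  finally show ?thesis by (simp add: T_def G_def)
qed

end

section \<open>Piecewise linear paths and convergence of the minimisers\<close>

lemma vec_angle_scaleR:
  assumes "a > 0" "b > 0" "norm v = 1" "norm w = 1"
  shows "vec_angle (a *\<^sub>R v) (b *\<^sub>R w) = arccos (inner v w)"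
  using assms by (simp add: vec_angle_def)

lemma inner_bounds_of_vec_angle:
  fixes v w :: "'a::real_inner"
  assumes v: "norm v = 1" "norm w = 1" and ab: "a > 0" "b > 0"
    and angle: "vec_angle (- (a *\<^sub>R v)) (b *\<^sub>R w) \<in> {0<..<pi}"
  shows "inner v w \<in> {-1<..<1}"
proof -
  have "vec_angle (- (a *\<^sub>R v)) (b *\<^sub>R w) = arccos (- inner v w)"
    using vec_angle_scaleR[of a b "-v" w] v ab by simp
  then have "- inner v w \<noteq> 1" "- inner v w \<noteq> -1"
    using angle by auto
  moreover have "\<bar>inner v w\<bar> \<le> 1"
    using Cauchy_Schwarz_ineq2[of v w] v by simp
  ultimately show ?thesis by auto
qed

context time_partition
begin

lemma segment_has_vector_derivative:
  fixes \<gamma> :: "real \<Rightarrow> 'a::real_normed_vector"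
  assumes \<gamma>: "\<And>t. t \<in> {\<tau> i..\<tau> (Suc i)} \<Longrightarrow> \<gamma> t = linepath a b ((t - \<tau> i) / (\<tau> (Suc i) - \<tau> i))"
    and t: "t \<in> {\<tau> i..\<tau> (Suc i)}"
  shows "(\<gamma> has_vector_derivative ((b - a) /\<^sub>R gap i)) (at t within {\<tau> i..\<tau> (Suc i)})"
proof -
  have "((\<lambda>t. a + ((t - \<tau> i) / gap i) *\<^sub>R (b - a)) has_vector_derivative ((b - a) /\<^sub>R gap i))
      (at t within {\<tau> i..\<tau> (Suc i)})"
    unfolding has_vector_derivative_def
    by (auto intro!: derivative_eq_intros simp: divide_inverse algebra_simps)
  then show ?thesis
    by (rule has_vector_derivative_transform[rotated 2])
      (use t \<gamma> in \<open>auto simp: linepath_def gap_def algebra_simps\<close>)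
qed

text \<open>
  At an interior vertex the one-sided derivatives are the directions of the two adjacent segments.
\<close>
lemma interior_of_segment_of_differentiable:
  fixes \<gamma> :: "real \<Rightarrow> 'a::real_normed_vector"
  assumes d: "\<And>i t. i < M \<Longrightarrow> t \<in> {\<tau> i..\<tau> (Suc i)} \<Longrightarrow>
      (\<gamma> has_vector_derivative v i) (at t within {\<tau> i..\<tau> (Suc i)})"
    and turn: "\<And>i. Suc i < M \<Longrightarrow> v i \<noteq> v (Suc i)"
    and \<theta>: "\<theta> \<in> {0<..<1}" "\<gamma> differentiable (at \<theta>)"
  shows "\<exists>i<M. \<theta> \<in> cell i"
proof (cases "\<theta> \<in> \<tau> ` {..M}")
  case False
  then show ?thesis using cell_exists \<theta>(1) by blast
next
  case True
  then obtain j where j: "j \<le> M" "\<theta> = \<tau> j" by auto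
  then have "j \<noteq> 0" "j \<noteq> M" using \<theta>(1) \<tau>_0 \<tau>_M by (metis greaterThanLessThan_iff less_irrefl)+
  then obtain i where i: "j = Suc i" "Suc i < M" using j(1) by (cases j) auto
  obtain D where D: "(\<gamma> has_vector_derivative D) (at \<theta>)"
    using \<theta>(2) vector_derivative_works by blast
  have "D = v k" if "k < M" "\<theta> \<in> {\<tau> k..\<tau> (Suc k)}" for k
  proof (rule vector_derivative_unique_within_closed_interval[of "\<tau> k" "\<tau> (Suc k)" \<theta> \<gamma>])
    show "(\<gamma> has_vector_derivative D) (at \<theta> within cbox (\<tau> k) (\<tau> (Suc k)))"
      using D by (rule has_vector_derivative_at_within)
    show "(\<gamma> has_vector_derivative v k) (at \<theta> within cbox (\<tau> k) (\<tau> (Suc k)))"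
      using d[OF that] by simp
  qed (use that \<tau>_less_Suc in auto)
  from this[of i] this[of "Suc i"] have "v i = v (Suc i)"
    using i j \<tau>_less_Suc[of i] \<tau>_less_Suc[of "Suc i"] by auto
  then show ?thesis using turn[OF i(2)] by blast
qed

end

lemma ins_pos_bounds:
  assumes "\<theta> > 0"
  shows "real (ins_pos \<theta> n) \<le> \<theta> * (real n + 2)" "\<theta> * (real n + 2) < real (ins_pos \<theta> n) + 1"
proof -
  have "\<theta> * (real n + 2) \<ge> 0" using assms by simp
  then have "real (ins_pos \<theta> n) = real_of_int \<lfloor>\<theta> * (real n + 2)\<rfloor>"
    by (simp add: ins_pos_def)
  then show "real (ins_pos \<theta> n) \<le> \<theta> * (real n + 2)" "\<theta> * (real n + 2) < real (ins_pos \<theta> n) + 1"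
    by linarith+
qed

lemma admissibleI:
  assumes \<theta>: "\<theta> \<in> {0<..<1}" and n: "n \<ge> 1" "1 \<le> \<theta> * real n"
  shows "admissible \<theta> n"
proof -
  have "real (ins_pos \<theta> n) < real (n + 2)"
  proof -
    have "real (ins_pos \<theta> n) \<le> \<theta> * (real n + 2)" using \<theta> ins_pos_bounds(1) by simp
    also have "\<dots> < 1 * (real n + 2)" using \<theta> by (intro mult_strict_right_mono) auto
    finally show ?thesis by simp
  qed
  moreover have "real (ins_pos \<theta> n) > 0"
    using ins_pos_bounds(2)[of \<theta> n] \<theta> n by (simp add: distrib_left)
  ultimately show ?thesis using n by (auto simp: admissible_def)
qed

theorem corollary5p1:
  fixes \<gamma> f :: "real \<Rightarrow> real^'d" and \<theta> :: real and xs :: "nat \<Rightarrow> real^'d"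
  assumes "nondegenerate_pl_path \<gamma>"
    and "\<And>t. t \<in> {0<..<1} \<Longrightarrow> \<gamma> differentiable (at t) \<Longrightarrow> (\<gamma> has_vector_derivative f t) (at t)"
    and "\<And>t. t \<in> {0<..<1} \<Longrightarrow> \<gamma> differentiable (at t) \<Longrightarrow> norm (f t) = 1"
    and "\<theta> \<in> {0<..<1}" and "\<gamma> differentiable (at \<theta>)"
    and "\<And>n. admissible \<theta> n \<Longrightarrow>
      is_arg_min
        (\<lambda>x. proj_norm (n+1) (\<lambda>is. insertion f (ins_pos \<theta> n) n x is - norm_signature f (n+1) is))
        (\<lambda>x. norm x = 1) (xs n)"
  shows "\<exists>r :: nat \<Rightarrow> nat. strict_mono r \<and> (\<forall>k. admissible \<theta> (r k)) \<and>
    (\<lambda>k. xs (r k)) \<longlonglongrightarrow> f \<theta>"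
proof -
  define P where "P M \<tau> x \<longleftrightarrow> \<tau> 0 = 0 \<and> \<tau> M = 1 \<and> (\<forall>i<M. \<tau> i < \<tau> (i+1)) \<and>
     (\<forall>i<M. x i \<noteq> x (i+1)) \<and>
     (\<forall>i<M. \<forall>t\<in>{\<tau> i..\<tau> (i+1)}.
        \<gamma> t = linepath (x i) (x (i+1)) ((t - \<tau> i) / (\<tau> (i+1) - \<tau> i))) \<and>
     (\<forall>i. 0 < i \<and> i < M \<longrightarrow> vec_angle (x (i-1) - x i) (x (i+1) - x i) \<in> {0<..<pi})"
    for M :: nat and \<tau> x
  have "\<exists>M \<tau> x. P M \<tau> x"
    using assms(1) unfolding nondegenerate_pl_path_def P_def .
  then obtain M \<tau> x where "P M \<tau> x" by blast
  note path = this[unfolded P_def]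
  have segment: "\<gamma> t = linepath (x i) (x (Suc i)) ((t - \<tau> i) / (\<tau> (Suc i) - \<tau> i))"
    if "i < M" "t \<in> {\<tau> i..\<tau> (Suc i)}" for i t
    using path that by simp
  have angle: "vec_angle (x i - x (Suc i)) (x (Suc (Suc i)) - x (Suc i)) \<in> {0<..<pi}"
    if "Suc i < M" for i
    using path that by (metis diff_Suc_1 Suc_eq_plus1 zero_less_Suc)
  interpret time_partition M \<tau>
    by standard (use path in auto)
  define v where "v i = (x (Suc i) - x i) /\<^sub>R gap i" for i
  have x_diff: "x (Suc i) - x i = gap i *\<^sub>R v i" if "i < M" for i
    using gap_pos[OF that] by (simp add: v_def)
  have d: "(\<gamma> has_vector_derivative v i) (at t within {\<tau> i..\<tau> (Suc i)})"
    if "i < M" "t \<in> {\<tau> i..\<tau> (Suc i)}" for i t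
    unfolding v_def using segment[OF that(1)] that(2) by (intro segment_has_vector_derivative) auto
  have d_cell: "(\<gamma> has_vector_derivative v i) (at t)" if "i < M" "t \<in> cell i" for i t
    using d[of i t] that by (simp add: cell_def at_within_Icc_at)
  have f: "f t = v i" if "i < M" "t \<in> cell i" for i t
  proof (rule vector_derivative_unique_at)
    have "t \<in> {0<..<1}" using cell_subset that by blast
    then show "(\<gamma> has_vector_derivative f t) (at t)"
      using assms(2) d_cell[OF that] differentiableI_vector by blast
  qed (rule d_cell[OF that])
  have v: "norm (v i) = 1" if i: "i < M" for i
  proof -
    obtain t where t: "t \<in> cell i" using \<tau>_less_Suc[OF i] dense by (auto simp: cell_def)
    then have "t \<in> {0<..<1}" using cell_subset i by blast
    then have "norm (f t) = 1" using assms(3) d_cell[OF i t] differentiableI_vector by blast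
    then show ?thesis using f[OF i t] by simp
  qed
  have turn: "inner (v i) (v (Suc i)) \<in> {-1<..<1}" if i: "Suc i < M" for i
  proof (rule inner_bounds_of_vec_angle)
    have "x i - x (Suc i) = - (gap i *\<^sub>R v i)"
      using x_diff[of i] i by (metis Suc_lessD minus_diff_eq)
    then show "vec_angle (- (gap i *\<^sub>R v i)) (gap (Suc i) *\<^sub>R v (Suc i)) \<in> {0<..<pi}"
      using angle[of i] x_diff[of "Suc i"] i by simp
  qed (use v gap_pos i in auto)
  have turn': "v i \<noteq> v (Suc i)" if "Suc i < M" for i
  proof
    assume "v i = v (Suc i)"
    then show False using turn[OF that] v[OF that] by (simp add: dot_square_norm)
  qed
  obtain i where i: "i < M" "\<theta> \<in> cell i"
    using interior_of_segment_of_differentiable[of \<gamma> v, OF d turn' assms(4,5)] by blast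
  have f\<theta>: "f \<theta> = v i" using f i by blast

  \<comment> \<open>The distance of \<open>\<theta>\<close> to the vertex times. Position \<open>p\<close> differs from \<open>(n+1) \<theta>\<close> by less than \<open>1\<close>, so for
    large \<open>n\<close> it keeps the distance \<open>(n+1) \<eta> / 2\<close> from \<open>(n+1) \<tau> i\<close> and \<open>(n+1) \<tau> (i+1)\<close>.\<close>
  define \<eta> where "\<eta> = min (\<theta> - \<tau> i) (\<tau> (Suc i) - \<theta>)"
  have \<eta>: "\<eta> > 0" "\<tau> i + \<eta> \<le> \<theta>" "\<theta> + \<eta> \<le> \<tau> (Suc i)" using i(2) by (auto simp: \<eta>_def cell_def)
  define b where "b n = (1 / gap i + 1) / sqrt (real (Suc n)) + 16 / (\<eta>\<^sup>2 * real (Suc n))" for n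
  have b_lim: "b \<longlonglongrightarrow> 0"
  proof -
    have "(\<lambda>n. (1 / gap i + 1) / sqrt (real (Suc n)) + 16 / \<eta>\<^sup>2 * (1 / real (Suc n))) \<longlonglongrightarrow> 0 + 16 / \<eta>\<^sup>2 * 0"
    proof (intro tendsto_add tendsto_mult tendsto_const)
      have "filterlim (\<lambda>n. sqrt (real (Suc n))) at_top sequentially"
        by (intro filterlim_compose[OF sqrt_at_top] filterlim_compose[OF filterlim_real_sequentially filterlim_Suc])
      then show "(\<lambda>n. (1 / gap i + 1) / sqrt (real (Suc n))) \<longlonglongrightarrow> 0"
        by (intro tendsto_divide_0[OF tendsto_const] filterlim_at_top_imp_at_infinity)
      show "(\<lambda>n. 1 / real (Suc n)) \<longlonglongrightarrow> 0"
        using LIMSEQ_inverse_real_of_nat by (simp add: inverse_eq_divide)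
    qed
    then show ?thesis by (simp add: b_def[abs_def])
  qed
  obtain n0 :: nat where n0: "1 / \<theta> + 2 / \<eta> + 1 \<le> real n0" using real_arch_simple by blast
  have large: "1 \<le> n" "1 \<le> \<theta> * real n" "2 \<le> \<eta> * real (Suc n)" if "n0 \<le> n" for n
  proof -
    have n: "1 / \<theta> + 2 / \<eta> + 1 \<le> real n" using that n0 by linarith
    have pos: "1 / \<theta> > 0" "2 / \<eta> > 0" using assms(4) \<eta>(1) by auto
    show "1 \<le> n" using n pos by linarith
    have "1 / \<theta> \<le> real n" using n pos by linarith
    then show "1 \<le> \<theta> * real n" using assms(4) by (simp add: divide_le_eq mult.commute)
    have "2 / \<eta> \<le> real (Suc n)" using n pos unfolding of_nat_Suc by linarith
    then show "2 \<le> \<eta> * real (Suc n)" using \<eta>(1) by (simp add: divide_le_eq mult.commute)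
  qed
  have adm: "admissible \<theta> n" if "n0 \<le> n" for n
    using admissibleI assms(4) large[OF that] by blast

  define Q where "Q n y = proj_norm (n+1) (\<lambda>is. insertion f (ins_pos \<theta> n) n y is - norm_signature f (n+1) is)" for n y
  have Q_tangent: "Q n (v i) \<le> b n" if n: "n0 \<le> n" for n
  proof -
    define N where "N = real (Suc n)"
    define p where "p = ins_pos \<theta> n"
    have p: "p \<in> {1..n+1}" using adm[OF n] by (simp add: admissible_def p_def)
    have N: "N > 0" "2 \<le> \<eta> * N" using large[OF n] by (simp_all add: N_def)
    have pN: "real p \<le> \<theta> * N + \<theta>" "\<theta> * N + \<theta> < real p + 1"
      using ins_pos_bounds[of \<theta> n] assms(4) by (simp_all add: N_def p_def algebra_simps)
    have le: "N * \<tau> i + N * \<eta> \<le> N * \<theta>" "N * \<theta> + N * \<eta> \<le> N * \<tau> (Suc i)"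
      using \<eta>(2,3) N(1) by (simp_all flip: distrib_left)
    have "N * \<tau> i + N * \<eta> / 2 \<le> real p" "real p + N * \<eta> / 2 \<le> N * \<tau> (Suc i) + 1"
      using le pN N(2) assms(4) by (auto simp: mult.commute)
    moreover have "N * \<eta> / 2 > 0" using N \<eta> by simp
    ultimately have "Q n (v i) \<le> (1 / gap i + 1) / sqrt N + 4 * N / (N * \<eta> / 2)\<^sup>2"
      using proj_norm_insertion_tangent_le[of f v i p n "N * \<eta> / 2", OF f v i(1) p]
      unfolding Q_def p_def N_def by simp
    also have "4 * N / (N * \<eta> / 2)\<^sup>2 = 16 / (\<eta>\<^sup>2 * N)"
      using N \<eta> by (simp add: power2_eq_square field_simps)
    finally show ?thesis by (simp add: b_def N_def)
  qed
  have Q_min: "Q n (xs n) \<le> Q n (v i)" if n: "n0 \<le> n" for n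
    using assms(6)[OF adm[OF n]] v[OF i(1)] unfolding is_arg_min_def Q_def by (auto simp: not_less)

  let ?z = "(v (M - 1), 1 :: real)"
  obtain \<delta> where \<delta>: "\<delta> > 0" "eventually (\<lambda>n. \<delta> \<le>
      norm (multinomial_word_sum gap (\<lambda>i. boost (v i)) ?z {..<M} n)) sequentially"
    using boost_word_sum_bounded_below[of M v gap] v turn gap_pos sum_gap by auto
  have "eventually (\<lambda>n. norm (xs n - f \<theta>) \<le> 2 * norm ?z / \<delta> * b n) sequentially"
    using \<delta>(2) eventually_ge_at_top[of n0]
  proof eventually_elim
    case (elim n)
    have p: "ins_pos \<theta> n \<in> {1..n+1}" using adm[OF elim(2)] by (simp add: admissible_def)
    have "norm (xs n - v i) * \<delta> \<le> norm (xs n - v i) *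
        norm (multinomial_word_sum gap (\<lambda>i. boost (v i)) ?z {..<M} n)"
      using elim(1) by (rule mult_left_mono) simp
    also have "\<dots> \<le> (Q n (xs n) + Q n (v i)) * norm ?z"
      unfolding Q_def by (rule dist_le_proj_norm_insertion) (use f p in auto)
    also have "\<dots> \<le> (b n + b n) * norm ?z"
      using Q_min[OF elim(2)] Q_tangent[OF elim(2)] by (intro mult_right_mono) auto
    finally show ?case using \<delta>(1) by (simp add: f\<theta> field_simps)
  qed
  moreover have "(\<lambda>n. 2 * norm ?z / \<delta> * b n) \<longlonglongrightarrow> 0"
    using b_lim by (rule tendsto_mult_right_zero)
  ultimately have "(\<lambda>n. xs n - f \<theta>) \<longlonglongrightarrow> 0" by (rule Lim_null_comparison)
  then have "xs \<longlonglongrightarrow> f \<theta>" by (simp add: LIM_zero_iff)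
  then have "(\<lambda>k. xs (k + n0)) \<longlonglongrightarrow> f \<theta>" by (rule LIMSEQ_ignore_initial_segment)
  moreover have "strict_mono (\<lambda>k. k + n0)" by (simp add: strict_mono_def)
  ultimately show ?thesis using adm by (intro exI[of _ "\<lambda>k. k + n0"]) auto
qed

end
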